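(* Fix $\kappa>0$, $\tau\in(0,1)$ and $c\in(0,1-\tau)$, and consider $\mu\le\mu_*$, where $\mu_*>0$ is such that the map $\mathcal{T}$ sends $\mathbb{S}_\mu$ into itself for all $\mu\in(0,\mu_*]$. Consider the solution $x^a$ of the approximating system for a given initial condition $\Delta(0)=\Delta^{(0)}\in\mathbb{S}_\mu$, and let $\Delta^{(k)}=\mathcal{T}(\Delta^{(k-1)})$, $k\ge1$. Then for any $\rho\in(0,1)$ there exists $\mu_{**}\le\mu_*$ such that, for all $\mu\le\mu_{**}$, $$|\Delta^{(k)}-\Delta^a_*|\le\frac{\rho^k}{1-\rho}|\Delta^{(1)}-\Delta^{(0)}|\le\delta_\mu\frac{\rho^k}{1-\rho},$$ where $\Delta^a_*$ is the value of the queue difference of the periodic equilibrium $u^a_*\,$ at the beginning of its cycle. In particular, $x^a_3$ converges to $u^a_*$ geometrically fast in the number of cycles.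
   Context: For $0<\mu<1$ define $\Delta_\mu^m=1-\mu+\kappa$, $\Delta_\mu^M=(1-\mu)(1-\tau)/\mu$, $\delta_\mu=\frac{1-\mu}{\mu}c+\kappa$, and $\mathbb{S}_\mu=[\Delta_\mu^M-\delta_\mu,\Delta_\mu^M]$; $\mu_*$ is taken small enough that $\mu_*<\mu_1=\frac{2+\kappa-\tau-\sqrt{(\kappa-\tau)^2+4\kappa}}{2}$, $1-\mu_*>-\log(1-\tau)$ and $\Delta_\mu^M-\delta_\mu>\Delta_\mu^m$ for $\mu\le\mu_*$. For $\Delta>\kappa$ let $T_1^a(\Delta)$ be the unique positive solution $T$ of $T=\frac{\Delta-1+\mu-\kappa}{1+\mu}+\frac{1-\mu}{1+\mu}e^{-T}$, and $$\mathcal{T}(\Delta)=-\kappa-\frac{1-\mu}{\mu}e^{-T_1^a(\Delta)}+\frac{1-\mu}{\mu}(1-\tau).$$ Approximating system (three-dimensional part), as long as both queues are positive: $x_3^a=(\Delta^a,z^a_{1,2},z^a_{2,1})$ with $\Delta^a=q_2^a-q_1^a$ (a queue difference), starting at $(\Delta(0),0,0)$ with $\Delta(0)>\kappa$. On $[0,T_1^a)$: $\dot\Delta^a(t)=-(1+\mu)-(1-\mu)e^{-t}$, $z_{1,2}^a=0$, $z^a_{2,1}(t)=1-e^{-t}$, where $T_1^a$ is the hitting time of $\kappa$ by $\Delta^a$. On $[T_1^a,\Sigma_2^a)$, $\Sigma^a_2=T_1^a+T_2^a$, $T_2^a=\mu^{-1}\log((1-e^{-T_1^a})/\tau)$: $z_{1,2}^a=0$,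 $z^a_{2,1}(T_1^a+t)=(1-e^{-T_1^a})e^{-\mu t}$, $\dot\Delta^a(T_1^a+t)=-(1-\mu)z^a_{2,1}(T_1^a+t)$. At $\Sigma_2^a$, $\Delta^a$ is continuous with $-\Delta^a(\Sigma_2^a)=\mathcal{T}(\Delta(0))$ and $z^a_{2,1}$ jumps from $\tau$ to $0$. If $-\Delta^a(\Sigma_2^a)>\kappa$ the same evolution is repeated with the labels $1,2$ interchanged (a second half cycle), and so on; two half cycles make a cycle. Each half cycle is one iteration, so $\Delta^{(k)}$ is the queue difference (with labels reversed as needed) after $k$ half cycles. A periodic equilibrium is a non-constant periodic solution; $u^a_*$ is the one whose cycle starts from $\Delta_*^a\in\mathbb{S}_\mu$. *)

theory Defs
  imports "HOL-Analysis.Analysis"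
begin

definition Delta_m :: "real \<Rightarrow> real \<Rightarrow> real" where
  "Delta_m \<kappa> \<mu> = 1 - \<mu> + \<kappa>"

definition Delta_M :: "real \<Rightarrow> real \<Rightarrow> real" where
  "Delta_M \<tau> \<mu> = (1 - \<mu>) * (1 - \<tau>) / \<mu>"

definition delta_mu :: "real \<Rightarrow> real \<Rightarrow> real \<Rightarrow> real" where
  "delta_mu \<kappa> c \<mu> = (1 - \<mu>) / \<mu> * c + \<kappa>"

definition S_mu :: "real \<Rightarrow> real \<Rightarrow> real \<Rightarrow> real \<Rightarrow> real set" where
  "S_mu \<kappa> \<tau> c \<mu> = {Delta_M \<tau> \<mu> - delta_mu \<kappa> c \<mu> .. Delta_M \<tau> \<mu>}"

definition mu_1 :: "real \<Rightarrow> real \<Rightarrow> real" where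
  "mu_1 \<kappa> \<tau> = (2 + \<kappa> - \<tau> - sqrt ((\<kappa> - \<tau>)^2 + 4 * \<kappa>)) / 2"

text \<open>For \<open>0 < \<mu> < 1\<close> and \<open>\<Delta> > \<kappa>\<close> the defining equation has exactly one positive solution, since its
  right-hand side is decreasing in \<open>T\<close> and positive at \<open>T = 0\<close>; only such arguments are meaningful.\<close>

definition T1a :: "real \<Rightarrow> real \<Rightarrow> real \<Rightarrow> real" where
  "T1a \<kappa> \<mu> \<Delta> =
     (THE T. 0 < T \<and> T = (\<Delta> - 1 + \<mu> - \<kappa>) / (1 + \<mu>) + (1 - \<mu>) / (1 + \<mu>) * exp (- T))"

definition Tmap :: "real \<Rightarrow> real \<Rightarrow> real \<Rightarrow> real \<Rightarrow> real" where
  "Tmap \<kappa> \<tau> \<mu> \<Delta> = - \<kappa> - (1 - \<mu>) / \<mu> * exp (- T1a \<kappa> \<mu> \<Delta>) + (1 - \<mu>) / \<mu> * (1 - \<tau>)"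

text \<open>A state is \<open>(\<Delta>, z\<^sub>1\<^sub>2, z\<^sub>2\<^sub>1)\<close> with \<open>\<Delta> = q\<^sub>2 - q\<^sub>1\<close>, so interchanging the labels 1 and 2 negates the
  first component and exchanges the other two.\<close>

type_synonym state = "real \<times> real \<times> real"

abbreviation qdiff :: "state \<Rightarrow> real" where "qdiff p \<equiv> fst p"
abbreviation z12 :: "state \<Rightarrow> real" where "z12 p \<equiv> fst (snd p)"
abbreviation z21 :: "state \<Rightarrow> real" where "z21 p \<equiv> snd (snd p)"

definition swap_labels :: "state \<Rightarrow> state" where
  "swap_labels p = (- qdiff p, z21 p, z12 p)"

text \<open>\<open>half_cycle \<kappa> \<tau> \<mu> x a b\<close>: on \<open>[a, b]\<close> the path \<open>x\<close> performs one half cycle in which \<open>\<Delta>\<close> starts above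
  \<open>\<kappa>\<close>. The first phase ends when \<open>\<Delta>\<close> hits \<open>\<kappa>\<close>, the second when \<open>z\<^sub>2\<^sub>1\<close> has decayed to \<open>\<tau>\<close>; at that time
  \<open>b\<close> it jumps to 0. Derivatives at the left end of a phase are one-sided. The condition \<open>0 \<le> T2\<close>
  says that \<open>z\<^sub>2\<^sub>1\<close> is not already below \<open>\<tau>\<close> at the end of the first phase.\<close>

definition half_cycle :: "real \<Rightarrow> real \<Rightarrow> real \<Rightarrow> (real \<Rightarrow> state) \<Rightarrow> real \<Rightarrow> real \<Rightarrow> bool" where
  "half_cycle \<kappa> \<tau> \<mu> x a b \<longleftrightarrow>
     \<kappa> < qdiff (x a) \<and>
     continuous_on {a..b} (\<lambda>t. qdiff (x t)) \<and>
     (\<exists>T1 T2. 0 < T1 \<and> T2 = ln ((1 - exp (- T1)) / \<tau>) / \<mu> \<and> 0 \<le> T2 \<and> b = a + T1 + T2 \<and>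
        (\<forall>t\<in>{a..<a + T1}.
           \<kappa> < qdiff (x t) \<and>
           ((\<lambda>t. qdiff (x t)) has_real_derivative - (1 + \<mu>) - (1 - \<mu>) * exp (- (t - a)))
             (at t within {a..<a + T1}) \<and>
           z12 (x t) = 0 \<and>
           z21 (x t) = 1 - exp (- (t - a))) \<and>
        qdiff (x (a + T1)) = \<kappa> \<and>
        (\<forall>t\<in>{a + T1..<b}.
           ((\<lambda>t. qdiff (x t)) has_real_derivative - (1 - \<mu>) * z21 (x t))
             (at t within {a + T1..<b}) \<and>
           z12 (x t) = 0 \<and>
           z21 (x t) = (1 - exp (- T1)) * exp (- \<mu> * (t - (a + T1)))) \<and>
        z12 (x b) = 0 \<and> z21 (x b) = 0)"

text \<open>A solution on \<open>[0, \<infinity>)\<close>; \<open>\<sigma> k\<close> is the time at which the \<open>k\<close>-th half cycle starts (\<open>k = 0, 1, \<dots>\<close>), and the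
  \<open>n\<close>-th cycle is \<open>[\<sigma> (2 * n), \<sigma> (2 * n + 2)]\<close>. The first conjunct of \<open>half_cycle\<close>, applied to the path with
  labels interchanged, is the condition under which a further half cycle takes place. Values at
  negative times are irrelevant.\<close>

definition approx_solution ::
    "real \<Rightarrow> real \<Rightarrow> real \<Rightarrow> real \<Rightarrow> (nat \<Rightarrow> real) \<Rightarrow> (real \<Rightarrow> state) \<Rightarrow> bool" where
  "approx_solution \<kappa> \<tau> \<mu> \<Delta>0 \<sigma> x \<longleftrightarrow>
     x 0 = (\<Delta>0, 0, 0) \<and>
     \<sigma> 0 = 0 \<and> filterlim \<sigma> at_top sequentially \<and>
     (\<forall>k. half_cycle \<kappa> \<tau> \<mu> (\<lambda>t. (swap_labels ^^ k) (x t)) (\<sigma> k) (\<sigma> (Suc k)))"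

definition nonconstant_periodic :: "(real \<Rightarrow> state) \<Rightarrow> bool" where
  "nonconstant_periodic u \<longleftrightarrow>
     (\<exists>P>0. \<forall>t\<ge>0. u (t + P) = u t) \<and> (\<exists>s\<ge>0. \<exists>t\<ge>0. u s \<noteq> u t)"

text \<open>A solution \<open>u\<close>, with half cycle times \<open>\<sigma>\<close>, that is a periodic equilibrium whose cycle starts
  from \<open>\<Delta>s\<close> in the interval \<open>S_mu\<close>. The period is not required to be a single cycle.\<close>

definition periodic_equilibrium_from ::
    "real \<Rightarrow> real \<Rightarrow> real \<Rightarrow> real \<Rightarrow> real \<Rightarrow> (nat \<Rightarrow> real) \<Rightarrow> (real \<Rightarrow> state) \<Rightarrow> bool" where
  "periodic_equilibrium_from \<kappa> \<tau> c \<mu> \<Delta>s \<sigma> u \<longleftrightarrow>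
     \<Delta>s \<in> S_mu \<kappa> \<tau> c \<mu> \<and> approx_solution \<kappa> \<tau> \<mu> \<Delta>s \<sigma> u \<and> nonconstant_periodic u"

text \<open>Geometric convergence, in the number \<open>n\<close> of cycles, of the \<open>n\<close>-th cycle of \<open>x\<close> to the cycle of
  \<open>u\<close>. The cycles have different lengths and the paths jump at different times, so the paths are
  compared, as in the Skorokhod \<open>J\<^sub>1\<close> metric, after an increasing change of time \<open>\<theta>\<close> that is itself
  geometrically close to a translation; a pointwise comparison would fail near the jumps.\<close>

definition cycles_converge_geometrically ::
    "real \<Rightarrow> (nat \<Rightarrow> real) \<Rightarrow> (real \<Rightarrow> state) \<Rightarrow> (nat \<Rightarrow> real) \<Rightarrow> (real \<Rightarrow> state) \<Rightarrow> bool" where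
  "cycles_converge_geometrically r \<sigma> x \<sigma>u u \<longleftrightarrow>
     (\<exists>C. \<forall>n. \<exists>\<theta>.
        strict_mono_on {0..\<sigma>u 2} \<theta> \<and> \<theta> ` {0..\<sigma>u 2} = {\<sigma> (2 * n)..\<sigma> (2 * n + 2)} \<and>
        (\<forall>s\<in>{0..\<sigma>u 2}. \<bar>\<theta> s - (\<sigma> (2 * n) + s)\<bar> \<le> C * r ^ n \<and> dist (x (\<theta> s)) (u s) \<le> C * r ^ n))"

end

theory Submission
  imports Defs "HOL-Real_Asymp.Real_Asymp"
begin

text \<open>
  Along a half cycle that starts from a queue difference \<open>\<Delta>\<close>, both phases can be integrated
  explicitly, so the state at time \<open>t\<close> is a closed expression \<open>profile \<Delta> t\<close>, and the half cycle
  ends, after a time \<open>len \<Delta>\<close>, in the relabelled state \<open>(\<T> \<Delta>, 0, 0)\<close>. A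
  solution therefore carries no more information than the orbit of its initial value under \<open>\<T>\<close>
  (\<open>approx_solution_iff\<close>).

  On the interval \<open>S_mu\<close> the map \<open>\<T>\<close> depends on \<open>\<Delta>\<close> only through
  \<open>(1 - \<mu>) / \<mu> * exp (- T\<^sub>1)\<close>, and \<open>T\<^sub>1\<close> is 1-Lipschitz in \<open>\<Delta>\<close>; hence \<open>\<T>\<close> has a Lipschitz
  constant of at most \<open>(1 - \<mu>) / \<mu> * exp (- m)\<close>, where \<open>m\<close> is a lower bound of \<open>T\<^sub>1\<close>
  (\<open>Tmap_lipschitz\<close>). Every point of \<open>S_mu\<close> is of order \<open>(1 - \<tau> - c) / \<mu>\<close>, and so is \<open>m\<close>: as \<open>\<mu>\<close>
  tends to 0 the exponential beats the factor \<open>1 / \<mu>\<close> and the constant falls below any given \<open>\<rho>\<close>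
  (\<open>eventually_small_mu\<close>). The same bound makes \<open>T\<^sub>1\<close> so long that \<open>z\<^sub>2\<^sub>1\<close> has passed \<open>\<tau>\<close> when the
  first phase ends, which is what a half cycle needs in order to be completed.

  Banach's theorem then gives the unique fixed point \<open>\<Delta>s\<close> and the geometric estimate, and the
  solution from \<open>\<Delta>s\<close> repeats itself after two half cycles. Any other periodic solution from
  \<open>S_mu\<close> can return to its initial state only at the end of an even number of half cycles, because
  \<open>z\<^sub>2\<^sub>1\<close> vanishes nowhere else; its initial value is then fixed by a power of \<open>\<T>\<close> and must be \<open>\<Delta>s\<close>
  (\<open>periodic_starts_at_fixed_point\<close>). Convergence of the paths follows since \<open>profile\<close> and \<open>len\<close> are
  Lipschitz, once each half cycle of one path is stretched affinely onto that of the other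
  (\<open>half_cycle_matching\<close>, \<open>traces_converge\<close>).
\<close>

section \<open>Elementary estimates and affine time changes\<close>

lemma exp_minus_lipschitz:
  fixes m x y :: real
  assumes "m \<le> x" "m \<le> y"
  shows "\<bar>exp (- x) - exp (- y)\<bar> \<le> exp (- m) * \<bar>x - y\<bar>"
proof -
  have *: "\<bar>exp (- x) - exp (- y)\<bar> \<le> exp (- m) * \<bar>x - y\<bar>" if "m \<le> x" "x \<le> y" for x y :: real
  proof -
    have "exp (- x) - exp (- y) = exp (- x) * (1 - exp (- (y - x)))"
      by (simp add: algebra_simps flip: exp_add)
    also have "\<dots> \<le> exp (- x) * (y - x)"
      by (intro mult_left_mono) (use exp_ge_add_one_self[of "- (y - x)"] in linarith, simp)
    also have "\<dots> \<le> exp (- m) * (y - x)"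
      using that by (intro mult_right_mono) auto
    finally show ?thesis using that by (simp add: abs_if)
  qed
  show ?thesis
    using *[of x y] *[of y x] assms by (cases "x \<le> y") (auto simp: abs_minus_commute)
qed

lemma abs_mult_diff_le:
  fixes a b a' b' :: real
  assumes "0 \<le> a'" "a' \<le> 1" "0 \<le> b" "b \<le> 1"
  shows "\<bar>a * b - a' * b'\<bar> \<le> \<bar>a - a'\<bar> + \<bar>b - b'\<bar>"
proof -
  have "a * b - a' * b' = (a - a') * b + a' * (b - b')" by (simp add: algebra_simps)
  also have "\<bar>\<dots>\<bar> \<le> \<bar>(a - a') * b\<bar> + \<bar>a' * (b - b')\<bar>" by (rule abs_triangle_ineq)
  also have "\<dots> \<le> \<bar>a - a'\<bar> * 1 + 1 * \<bar>b - b'\<bar>"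
    unfolding abs_mult using assms by (intro add_mono mult_mono) auto
  finally show ?thesis by simp
qed

text \<open>The affine stretchings of two consecutive half cycles, each of length \<open>\<Sigma>\<close>, onto half
  cycles of lengths \<open>L\<close> and \<open>L'\<close> agree at the junction, so together they form a change of time.\<close>

lemma two_piece_affine:
  fixes a L L' \<Sigma> :: real
  assumes "0 < \<Sigma>" "0 < L" "0 < L'"
  defines "\<theta> \<equiv> \<lambda>s. if s < \<Sigma> then a + s * (L / \<Sigma>) else a + L + (s - \<Sigma>) * (L' / \<Sigma>)"
  shows "strict_mono_on {0..2 * \<Sigma>} \<theta>" "\<theta> ` {0..2 * \<Sigma>} = {a..a + L + L'}"
proof -
  have lower: "s * (L / \<Sigma>) < t * (L / \<Sigma>)" if "s < t" for s t
    using that assms(1-3) by (intro mult_strict_right_mono) auto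
  have upper: "s * (L' / \<Sigma>) < t * (L' / \<Sigma>)" if "s < t" for s t
    using that assms(1-3) by (intro mult_strict_right_mono) auto
  have SL: "\<Sigma> * (L / \<Sigma>) = L" "\<Sigma> * (L' / \<Sigma>) = L'" using assms by auto
  have mono: "\<theta> s < \<theta> t" if "s < t" for s t
  proof -
    consider "t < \<Sigma>" | "s < \<Sigma>" "\<Sigma> \<le> t" | "\<Sigma> \<le> s" by linarith
    then show ?thesis
    proof cases
      case 2
      have "0 \<le> (t - \<Sigma>) * (L' / \<Sigma>)" using 2 assms by auto
      then show ?thesis using 2 lower[of s \<Sigma>] SL by (auto simp: \<theta>_def)
    qed (use that lower[of s t] upper[of "s - \<Sigma>" "t - \<Sigma>"] in \<open>auto simp: \<theta>_def\<close>)
  qed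
  then show "strict_mono_on {0..2 * \<Sigma>} \<theta>" by (auto intro: strict_mono_onI)
  have ends: "\<theta> 0 = a" "\<theta> (2 * \<Sigma>) = a + L + L'" using assms SL by (auto simp: \<theta>_def)
  have le: "\<theta> s \<le> \<theta> t" if "s \<le> t" for s t
    using that mono[of s t] by (cases "s = t") auto
  show "\<theta> ` {0..2 * \<Sigma>} = {a..a + L + L'}"
  proof (intro equalityI subsetI)
    fix y assume "y \<in> \<theta> ` {0..2 * \<Sigma>}"
    then show "y \<in> {a..a + L + L'}" using le ends by (metis atLeastAtMost_iff imageE)
  next
    fix y assume y: "y \<in> {a..a + L + L'}"
    show "y \<in> \<theta> ` {0..2 * \<Sigma>}"
    proof (cases "y < a + L")
      case True
      define s where "s = (y - a) / L * \<Sigma>"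
      have "(y - a) / L * \<Sigma> < 1 * \<Sigma>"
        using True assms by (intro mult_strict_right_mono) (auto simp: field_simps)
      then have "s < \<Sigma>" by (simp add: s_def)
      moreover have "0 \<le> s" using y assms by (auto simp: s_def)
      moreover have "s * (L / \<Sigma>) = y - a" using assms by (simp add: s_def)
      ultimately show ?thesis by (intro image_eqI[of _ _ s]) (auto simp: \<theta>_def)
    next
      case False
      define s where "s = \<Sigma> + (y - a - L) / L' * \<Sigma>"
      have "(y - a - L) / L' * \<Sigma> \<le> 1 * \<Sigma>"
        using y assms by (intro mult_right_mono) (auto simp: field_simps)
      moreover have "0 \<le> (y - a - L) / L' * \<Sigma>" using False assms by auto
      moreover have "(s - \<Sigma>) * (L' / \<Sigma>) = y - a - L" using assms by (simp add: s_def)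
      ultimately show ?thesis
        by (intro image_eqI[of _ _ s]) (auto simp: \<theta>_def s_def)
    qed
  qed
qed

section \<open>Interchanging the labels\<close>

lemma swap_labels_Pair [simp]: "swap_labels (d, y, z) = (- d, z, y)"
  by (simp add: swap_labels_def)

lemma swap_labels_twice [simp]: "swap_labels (swap_labels p) = p"
  by (simp add: swap_labels_def)

lemma swap_labels_pow_twice [simp]: "(swap_labels ^^ k) ((swap_labels ^^ k) p) = p"
proof (induction k arbitrary: p)
  case (Suc k)
  have "(swap_labels ^^ k) (swap_labels q) = swap_labels ((swap_labels ^^ k) q)" for q
    by (simp only: funpow_swap1)
  then show ?case by (simp add: Suc.IH)
qed simp

lemma swap_labels_pow_eq_iff: "(swap_labels ^^ k) p = q \<longleftrightarrow> p = (swap_labels ^^ k) q"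
  by (metis swap_labels_pow_twice)

lemma swap_labels_pow_even [simp]: "(swap_labels ^^ (2 * k)) p = p"
  by (simp add: funpow_add mult_2)

lemma dist_swap_labels: "dist (swap_labels p) (swap_labels q) = dist p q"
  by (cases p, cases q)
    (simp add: swap_labels_def dist_Pair_Pair dist_real_def abs_minus_commute add.commute)

lemma swap_labels_pow_queue: "(swap_labels ^^ k) (d, 0, 0) = ((- 1) ^ k * d, 0, 0)"
  by (induction k) auto

lemma dist_swap_labels_pow:
  "dist ((swap_labels ^^ k) p) ((swap_labels ^^ k) q) = dist p q"
  by (induction k) (auto simp: dist_swap_labels)

section \<open>The hitting time and the contraction estimate\<close>

text \<open>The distance by which the queue difference has decreased at time \<open>t\<close> of the first phase: the
  integral of \<open>(1 + \<mu>) + (1 - \<mu>) * exp (- s)\<close> over \<open>s\<close> from 0 to \<open>t\<close>.\<close>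

definition fall :: "real \<Rightarrow> real \<Rightarrow> real" where
  "fall \<mu> t = (1 + \<mu>) * t + (1 - \<mu>) * (1 - exp (- t))"

lemma has_derivative_fall [derivative_intros]:
  assumes "(f has_real_derivative f') (at t within X)"
  shows "((\<lambda>t. fall \<mu> (f t)) has_real_derivative ((1 + \<mu>) + (1 - \<mu>) * exp (- f t)) * f') (at t within X)"
  unfolding fall_def by (auto intro!: derivative_eq_intros assms simp: algebra_simps)

lemma continuous_on_fall [continuous_intros]:
  "continuous_on X f \<Longrightarrow> continuous_on X (\<lambda>t. fall \<mu> (f t))"
  unfolding fall_def by (intro continuous_intros)

locale approximating_system =
  fixes \<kappa> \<tau> \<mu> :: real
  assumes kappa: "0 < \<kappa>" and tau: "0 < \<tau>" "\<tau> < 1" and mu: "0 < \<mu>" "\<mu> < 1"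
begin

abbreviation T1 :: "real \<Rightarrow> real" where "T1 \<equiv> T1a \<kappa> \<mu>"

definition len :: "real \<Rightarrow> real" where
  "len \<Delta> = T1 \<Delta> + ln ((1 - exp (- T1 \<Delta>)) / \<tau>) / \<mu>"

text \<open>Both phases in one formula without case distinction: \<open>max 0\<close> switches off the fall of \<open>\<Delta>\<close>
  once \<open>\<kappa>\<close> is reached and the decay of \<open>z\<^sub>2\<^sub>1\<close> until then, and \<open>min\<close> stops the growth of \<open>z\<^sub>2\<^sub>1\<close>. As
  these operations are Lipschitz, so is the profile, jointly in \<open>\<Delta>\<close> and \<open>t\<close>, although the hitting
  time depends on \<open>\<Delta>\<close>. The jump of \<open>z\<^sub>2\<^sub>1\<close> to 0 at the end of a half cycle is not part of it.\<close>

definition profile :: "real \<Rightarrow> real \<Rightarrow> state" where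
  "profile \<Delta> t =
     (\<kappa> + max 0 (\<Delta> - \<kappa> - fall \<mu> t)
        - (1 - \<mu>) / \<mu> * ((1 - exp (- T1 \<Delta>)) * (1 - exp (- \<mu> * max 0 (t - T1 \<Delta>)))),
      0, (1 - exp (- min t (T1 \<Delta>))) * exp (- \<mu> * max 0 (t - T1 \<Delta>)))"

text \<open>The derivative of \<open>fall \<mu>\<close> lies between \<open>1 + \<mu>\<close> and 2 at nonnegative times. The lower bound
  makes the hitting time unique and 1-Lipschitz in the starting value.\<close>

lemma fall_diff:
  assumes "s \<le> t"
  shows "(1 + \<mu>) * (t - s) \<le> fall \<mu> t - fall \<mu> s" "0 \<le> s \<Longrightarrow> fall \<mu> t - fall \<mu> s \<le> 2 * (t - s)"
proof -
  have eq: "fall \<mu> t - fall \<mu> s = (1 + \<mu>) * (t - s) + (1 - \<mu>) * (exp (- s) - exp (- t))"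
    by (simp add: fall_def algebra_simps)
  have "0 \<le> (1 - \<mu>) * (exp (- s) - exp (- t))" using assms mu by simp
  then show "(1 + \<mu>) * (t - s) \<le> fall \<mu> t - fall \<mu> s" using eq by simp
  assume "0 \<le> s"
  then have "exp (- s) - exp (- t) \<le> t - s"
    using exp_minus_lipschitz[of 0 s t] assms by simp
  then have "(1 - \<mu>) * (exp (- s) - exp (- t)) \<le> (1 - \<mu>) * (t - s)"
    using mu by (intro mult_left_mono) auto
  then show "fall \<mu> t - fall \<mu> s \<le> 2 * (t - s)" using eq by (simp add: algebra_simps)
qed

lemma abs_fall_diff:
  shows "\<bar>t - s\<bar> \<le> \<bar>fall \<mu> t - fall \<mu> s\<bar>"
    and "0 \<le> s \<Longrightarrow> 0 \<le> t \<Longrightarrow> \<bar>fall \<mu> t - fall \<mu> s\<bar> \<le> 2 * \<bar>t - s\<bar>"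
proof -
  have *: "0 \<le> \<mu> * \<bar>t - s\<bar>" using mu by simp
  then show "\<bar>t - s\<bar> \<le> \<bar>fall \<mu> t - fall \<mu> s\<bar>"
    using fall_diff(1)[of s t] fall_diff(1)[of t s] by (cases "s \<le> t") (auto simp: algebra_simps)
  show "\<bar>fall \<mu> t - fall \<mu> s\<bar> \<le> 2 * \<bar>t - s\<bar>" if "0 \<le> s" "0 \<le> t"
    using fall_diff[of s t] fall_diff[of t s] that * by (cases "s \<le> t") (auto simp: algebra_simps)
qed

lemma fall_0 [simp]: "fall \<mu> 0 = 0"
  by (simp add: fall_def)

lemma fall_less_iff [simp]: "fall \<mu> s < fall \<mu> t \<longleftrightarrow> s < t"
proof -
  have "fall \<mu> s < fall \<mu> t" if "s < t" for s t
  proof -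
    have "0 < (1 + \<mu>) * (t - s)" using mu that by simp
    then show ?thesis using fall_diff(1)[of s t] that by linarith
  qed
  then show ?thesis by (metis less_irrefl linorder_neqE order.asym)
qed

lemma fall_le_iff [simp]: "fall \<mu> s \<le> fall \<mu> t \<longleftrightarrow> s \<le> t"
  using fall_less_iff[of t s] by linarith

lemma fall_eq_iff [simp]: "fall \<mu> s = fall \<mu> t \<longleftrightarrow> s = t"
  using fall_less_iff[of t s] fall_less_iff[of s t] by linarith

text \<open>The defining equation of \<open>T\<^sub>1\<close> says that \<open>\<Delta>\<close> has fallen to \<open>\<kappa>\<close>.\<close>

lemma T1_equation_iff:
  "T = (\<Delta> - 1 + \<mu> - \<kappa>) / (1 + \<mu>) + (1 - \<mu>) / (1 + \<mu>) * exp (- T) \<longleftrightarrow> fall \<mu> T = \<Delta> - \<kappa>"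
  (is "?l \<longleftrightarrow> _")
proof -
  have "?l \<longleftrightarrow> T * (1 + \<mu>) = (\<Delta> - 1 + \<mu> - \<kappa>) + (1 - \<mu>) * exp (- T)"
    using mu by (simp add: eq_divide_eq flip: add_divide_distrib)
  then show ?thesis by (auto simp: fall_def algebra_simps)
qed

lemma T1:
  assumes "\<kappa> < \<Delta>"
  shows T1_pos: "0 < T1 \<Delta>" and fall_T1: "fall \<mu> (T1 \<Delta>) = \<Delta> - \<kappa>"
proof -
  have "\<Delta> - \<kappa> \<le> fall \<mu> (\<Delta> - \<kappa>)"
    using abs_fall_diff(1)[of "\<Delta> - \<kappa>" 0] fall_le_iff[of 0 "\<Delta> - \<kappa>"] assms by (simp del: fall_le_iff)
  then obtain T where T: "0 \<le> T" "fall \<mu> T = \<Delta> - \<kappa>"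
    using IVT'[of "fall \<mu>" 0 "\<Delta> - \<kappa>" "\<Delta> - \<kappa>"] assms
    by (auto intro!: continuous_intros continuous_on_fall[of _ "\<lambda>x. x"])
  have "T \<noteq> 0" using T assms by auto
  with T have "\<exists>!T. 0 < T \<and> T = (\<Delta> - 1 + \<mu> - \<kappa>) / (1 + \<mu>) + (1 - \<mu>) / (1 + \<mu>) * exp (- T)"
    unfolding T1_equation_iff by (metis fall_eq_iff less_eq_real_def)
  from theI'[OF this, folded T1a_def]
  show "0 < T1 \<Delta>" "fall \<mu> (T1 \<Delta>) = \<Delta> - \<kappa>" by (simp_all only: T1_equation_iff)
qed

lemma T1_unique: "\<kappa> < \<Delta> \<Longrightarrow> fall \<mu> T = \<Delta> - \<kappa> \<Longrightarrow> T = T1 \<Delta>"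
  by (metis fall_T1 fall_eq_iff)

lemma T1_lipschitz:
  assumes "\<kappa> < \<Delta>" "\<kappa> < \<Delta>'"
  shows "\<bar>T1 \<Delta> - T1 \<Delta>'\<bar> \<le> \<bar>\<Delta> - \<Delta>'\<bar>"
  using abs_fall_diff(1)[of "T1 \<Delta>" "T1 \<Delta>'"] fall_T1[OF assms(1)] fall_T1[OF assms(2)] by simp

lemma T1_ge:
  assumes "\<kappa> < \<Delta>"
  shows "(\<Delta> - 1 + \<mu> - \<kappa>) / (1 + \<mu>) \<le> T1 \<Delta>"
proof -
  have "0 \<le> (1 - \<mu>) / (1 + \<mu>) * exp (- T1 \<Delta>)" using mu by simp
  then show ?thesis using fall_T1[OF assms] unfolding T1_equation_iff[symmetric] by linarith
qed

text \<open>The smallness comes entirely from \<open>exp (- T\<^sub>1)\<close>: a late hitting time means that \<open>z\<^sub>2\<^sub>1\<close> is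
  already almost 1 when the second phase begins, so hardly any trace of \<open>\<Delta>\<close> is left.\<close>

lemma Tmap_lipschitz:
  assumes "\<kappa> < \<Delta>" "\<kappa> < \<Delta>'" "m \<le> T1 \<Delta>" "m \<le> T1 \<Delta>'"
  shows "\<bar>Tmap \<kappa> \<tau> \<mu> \<Delta> - Tmap \<kappa> \<tau> \<mu> \<Delta>'\<bar> \<le> (1 - \<mu>) / \<mu> * exp (- m) * \<bar>\<Delta> - \<Delta>'\<bar>"
proof -
  have "Tmap \<kappa> \<tau> \<mu> \<Delta> - Tmap \<kappa> \<tau> \<mu> \<Delta>' = (1 - \<mu>) / \<mu> * (exp (- T1 \<Delta>') - exp (- T1 \<Delta>))"
    by (simp add: Tmap_def algebra_simps)
  then have "\<bar>Tmap \<kappa> \<tau> \<mu> \<Delta> - Tmap \<kappa> \<tau> \<mu> \<Delta>'\<bar> = (1 - \<mu>) / \<mu> * \<bar>exp (- T1 \<Delta>') - exp (- T1 \<Delta>)\<bar>"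
    using mu by (simp add: abs_mult)
  also have "\<dots> \<le> (1 - \<mu>) / \<mu> * (exp (- m) * \<bar>\<Delta> - \<Delta>'\<bar>)"
  proof (rule mult_left_mono)
    have "\<bar>exp (- T1 \<Delta>') - exp (- T1 \<Delta>)\<bar> \<le> exp (- m) * \<bar>T1 \<Delta>' - T1 \<Delta>\<bar>"
      by (rule exp_minus_lipschitz) (use assms in auto)
    also have "\<dots> \<le> exp (- m) * \<bar>\<Delta> - \<Delta>'\<bar>"
      using T1_lipschitz[of \<Delta> \<Delta>'] assms by (intro mult_left_mono) auto
    finally show "\<bar>exp (- T1 \<Delta>') - exp (- T1 \<Delta>)\<bar> \<le> exp (- m) * \<bar>\<Delta> - \<Delta>'\<bar>" .
  qed (use mu in auto)
  finally show ?thesis by (simp add: mult.assoc)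
qed

section \<open>Half cycles in closed form\<close>

text \<open>Under the second condition \<open>z\<^sub>2\<^sub>1\<close> has reached \<open>\<tau>\<close> by the end of the first phase, so the
  decay time that enters \<open>len \<Delta>\<close> is nonnegative.\<close>

definition completes_half_cycle :: "real \<Rightarrow> bool" where
  "completes_half_cycle \<Delta> \<longleftrightarrow> \<kappa> < \<Delta> \<and> \<tau> \<le> 1 - exp (- T1 \<Delta>)"

lemma completes_half_cycleD:
  assumes "completes_half_cycle \<Delta>"
  shows "\<kappa> < \<Delta>" "\<tau> \<le> 1 - exp (- T1 \<Delta>)" "0 < T1 \<Delta>" "T1 \<Delta> \<le> len \<Delta>" "0 < len \<Delta>"
    "- ln (1 - \<tau>) \<le> len \<Delta>"
proof -
  show *: "\<kappa> < \<Delta>" "\<tau> \<le> 1 - exp (- T1 \<Delta>)" using assms by (auto simp: completes_half_cycle_def)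
  show T1: "0 < T1 \<Delta>" using T1_pos * by blast
  have "0 \<le> ln ((1 - exp (- T1 \<Delta>)) / \<tau>) / \<mu>" using * mu tau by (auto intro!: divide_nonneg_pos ln_ge_zero)
  then show "T1 \<Delta> \<le> len \<Delta>" by (simp add: len_def)
  with T1 show "0 < len \<Delta>" by linarith
  have "ln (exp (- T1 \<Delta>)) \<le> ln (1 - \<tau>)" using * tau by (subst ln_le_cancel_iff) auto
  then show "- ln (1 - \<tau>) \<le> len \<Delta>" using \<open>T1 \<Delta> \<le> len \<Delta>\<close> by simp
qed

text \<open>The length of the second phase is the time in which \<open>z\<^sub>2\<^sub>1\<close> decays to \<open>\<tau>\<close>.\<close>

lemma exp_len:
  assumes "completes_half_cycle \<Delta>"
  shows "(1 - exp (- T1 \<Delta>)) * exp (- \<mu> * (len \<Delta> - T1 \<Delta>)) = \<tau>"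
  using completes_half_cycleD[OF assms] tau mu
  by (simp add: len_def exp_minus field_simps)

lemma profile_0: "\<kappa> < \<Delta> \<Longrightarrow> profile \<Delta> 0 = (\<Delta>, 0, 0)"
  using T1_pos[of \<Delta>] by (simp add: profile_def)

lemma profile_first:
  assumes "\<kappa> < \<Delta>" "t \<le> T1 \<Delta>"
  shows "profile \<Delta> t = (\<Delta> - fall \<mu> t, 0, 1 - exp (- t))"
proof -
  have "fall \<mu> t \<le> \<Delta> - \<kappa>" using fall_T1[OF assms(1)] assms(2) by (metis fall_le_iff)
  then show ?thesis using assms by (simp add: profile_def)
qed

lemma profile_second:
  assumes "\<kappa> < \<Delta>" "T1 \<Delta> \<le> t"
  shows "profile \<Delta> t =
    (\<kappa> - (1 - \<mu>) / \<mu> * ((1 - exp (- T1 \<Delta>)) * (1 - exp (- \<mu> * (t - T1 \<Delta>)))), 0,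
     (1 - exp (- T1 \<Delta>)) * exp (- \<mu> * (t - T1 \<Delta>)))"
proof -
  have "\<Delta> - \<kappa> \<le> fall \<mu> t" using fall_T1[OF assms(1)] assms(2) by (metis fall_le_iff)
  then show ?thesis using assms by (simp add: profile_def)
qed

lemma qdiff_profile_len:
  assumes "completes_half_cycle \<Delta>"
  shows "qdiff (profile \<Delta> (len \<Delta>)) = - Tmap \<kappa> \<tau> \<mu> \<Delta>"
proof -
  have "(1 - exp (- T1 \<Delta>)) * (1 - exp (- \<mu> * (len \<Delta> - T1 \<Delta>))) = 1 - exp (- T1 \<Delta>) - \<tau>"
    using exp_len[OF assms] by (simp only: right_diff_distrib mult_1_right)
  moreover have "qdiff (profile \<Delta> (len \<Delta>)) = \<kappa> - (1 - \<mu>) / \<mu> *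
      ((1 - exp (- T1 \<Delta>)) * (1 - exp (- \<mu> * (len \<Delta> - T1 \<Delta>))))"
    using profile_second[of \<Delta> "len \<Delta>"] completes_half_cycleD[OF assms] by simp
  ultimately have "qdiff (profile \<Delta> (len \<Delta>)) = \<kappa> - (1 - \<mu>) / \<mu> * (1 - exp (- T1 \<Delta>) - \<tau>)"
    by (simp only:)
  moreover have "K - c * (1 - e - \<tau>) = - (- K - c * e + c * (1 - \<tau>))" for K c e :: real
    by (simp add: algebra_simps)
  ultimately show ?thesis by (simp only: Tmap_def)
qed

lemma z21_profile_pos: "\<kappa> < \<Delta> \<Longrightarrow> 0 < t \<Longrightarrow> 0 < z21 (profile \<Delta> t)"
  using T1_pos[of \<Delta>] by (auto simp: profile_def)

lemma continuous_on_qdiff_profile: "continuous_on X (\<lambda>t. qdiff (profile \<Delta> (t - a)))"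
  unfolding profile_def using mu by (auto intro!: continuous_intros)

text \<open>In each phase the path and the formula have the same derivative in the interior, and continuity of
  the queue difference on the closed interval carries the equality to the ends. That the
  hitting time is \<open>T1 \<Delta>\<close> comes out of the integrated first phase.\<close>

lemma half_cycle_imp_profile:
  assumes "half_cycle \<kappa> \<tau> \<mu> x a b"
  defines "\<Delta> \<equiv> qdiff (x a)"
  shows "completes_half_cycle \<Delta>" "b = a + len \<Delta>" "\<And>t. t \<in> {a..<b} \<Longrightarrow> x t = profile \<Delta> (t - a)"
    "x b = (- Tmap \<kappa> \<tau> \<mu> \<Delta>, 0, 0)"
proof -
  obtain S1 S2 where D: "\<kappa> < \<Delta>" and cont: "continuous_on {a..b} (\<lambda>t. qdiff (x t))"
    and S: "0 < S1" "S2 = ln ((1 - exp (- S1)) / \<tau>) / \<mu>" "0 \<le> S2" "b = a + S1 + S2"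
    and first: "\<And>t. t \<in> {a..<a + S1} \<Longrightarrow>
           ((\<lambda>t. qdiff (x t)) has_real_derivative - (1 + \<mu>) - (1 - \<mu>) * exp (- (t - a)))
             (at t within {a..<a + S1}) \<and>
           z12 (x t) = 0 \<and> z21 (x t) = 1 - exp (- (t - a))"
    and hit: "qdiff (x (a + S1)) = \<kappa>"
    and second: "\<And>t. t \<in> {a + S1..<b} \<Longrightarrow>
           ((\<lambda>t. qdiff (x t)) has_real_derivative - (1 - \<mu>) * z21 (x t))
             (at t within {a + S1..<b}) \<and>
           z12 (x t) = 0 \<and>
           z21 (x t) = (1 - exp (- S1)) * exp (- \<mu> * (t - (a + S1)))"
    and zb: "z12 (x b) = 0" "z21 (x b) = 0"
    using assms(1) unfolding half_cycle_def \<Delta>_def by metis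
  have q1: "qdiff (x t) = \<Delta> - fall \<mu> (t - a)" if t: "t \<in> {a..a + S1}" for t
  proof -
    have "qdiff (x t) + fall \<mu> (t - a) = qdiff (x a) + fall \<mu> (a - a)"
    proof (rule DERIV_isconst2[of a "a + S1"])
      show "continuous_on {a..a + S1} (\<lambda>t. qdiff (x t) + fall \<mu> (t - a))"
        using S by (intro continuous_intros continuous_on_subset[OF cont]) auto
      fix s assume s: "a < s" "s < a + S1"
      then have "at s within {a..<a + S1} = at s"
        by (intro at_within_interior) (auto simp: interior_atLeastLessThan)
      then show "DERIV (\<lambda>t. qdiff (x t) + fall \<mu> (t - a)) s :> 0"
        using first[of s] s by (auto intro!: derivative_eq_intros simp: algebra_simps)
    qed (use S t in auto)
    then show ?thesis by (simp add: \<Delta>_def)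
  qed
  have S1: "S1 = T1 \<Delta>" using q1[of "a + S1"] hit S(1) by (intro T1_unique D) auto
  have "\<tau> \<le> 1 - exp (- S1)"
  proof (rule ccontr)
    assume "\<not> \<tau> \<le> 1 - exp (- S1)"
    then have "0 < (1 - exp (- S1)) / \<tau>" "(1 - exp (- S1)) / \<tau> < 1" using S(1) tau by auto
    then have "S2 < 0" using mu S by (auto simp: divide_neg_pos)
    then show False using S by simp
  qed
  then show cpl: "completes_half_cycle \<Delta>" using D S1 by (simp add: completes_half_cycle_def)
  show b: "b = a + len \<Delta>" using S S1 by (simp add: len_def)
  (* The second phase may have length 0; there is then no interior on which to integrate. *)
  have q2: "qdiff (x t) = \<kappa> - (1 - \<mu>) / \<mu> * ((1 - exp (- S1)) * (1 - exp (- \<mu> * (t - (a + S1)))))"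
    if t: "t \<in> {a + S1..b}" for t
  proof (cases "S2 = 0")
    case True
    then have "t = a + S1" using t S by auto
    then show ?thesis using hit by simp
  next
    case False
    define g where "g = (\<lambda>t. (1 - \<mu>) / \<mu> * ((1 - exp (- S1)) * (1 - exp (- \<mu> * (t - (a + S1))))))"
    have "qdiff (x t) + g t = qdiff (x (a + S1)) + g (a + S1)"
    proof (rule DERIV_isconst2[of "a + S1" b])
      show "continuous_on {a + S1..b} (\<lambda>t. qdiff (x t) + g t)" unfolding g_def
        using S by (intro continuous_intros continuous_on_subset[OF cont]) auto
      fix s assume s: "a + S1 < s" "s < b"
      then have at: "at s within {a + S1..<b} = at s"
        by (intro at_within_interior) (auto simp: interior_atLeastLessThan)
      have "DERIV g s :> (1 - \<mu>) * ((1 - exp (- S1)) * exp (- \<mu> * (s - (a + S1))))"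
        unfolding g_def using mu by (auto intro!: derivative_eq_intros)
      moreover have "DERIV (\<lambda>t. qdiff (x t)) s :> - (1 - \<mu>) * z21 (x s)"
        "z21 (x s) = (1 - exp (- S1)) * exp (- \<mu> * (s - (a + S1)))"
        using second[of s] s at by auto
      ultimately show "DERIV (\<lambda>t. qdiff (x t) + g t) s :> 0"
        by (auto intro!: derivative_eq_intros simp: left_diff_distrib)
    qed (use S(3,4) t False in auto)
    then show ?thesis using hit by (simp add: g_def)
  qed
  show "x t = profile \<Delta> (t - a)" if t: "t \<in> {a..<b}" for t
  proof (cases "t < a + S1")
    case True
    then show ?thesis using q1[of t] first[of t] t S1 D by (simp add: profile_first prod_eq_iff)
  next
    case False
    then show ?thesis using q2[of t] second[of t] t S1 D
      by (simp add: profile_second prod_eq_iff diff_diff_eq)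
  qed
  have "qdiff (x b) = \<kappa> - (1 - \<mu>) / \<mu> * ((1 - exp (- S1)) * (1 - exp (- \<mu> * (b - (a + S1)))))"
    by (rule q2) (use S(3,4) in auto)
  also have "b - (a + S1) = len \<Delta> - T1 \<Delta>" using b S1 by simp
  finally have "qdiff (x b) = qdiff (profile \<Delta> (len \<Delta>))"
    using S1 completes_half_cycleD[OF cpl] by (simp add: profile_second)
  then show "x b = (- Tmap \<kappa> \<tau> \<mu> \<Delta>, 0, 0)"
    using zb qdiff_profile_len[OF cpl] by (simp add: prod_eq_iff)
qed

lemma half_cycle_profile:
  assumes cpl: "completes_half_cycle \<Delta>" and b: "b = a + len \<Delta>"
    and x: "\<And>t. t \<in> {a..<b} \<Longrightarrow> x t = profile \<Delta> (t - a)" and xb: "x b = (- Tmap \<kappa> \<tau> \<mu> \<Delta>, 0, 0)"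
  shows "half_cycle \<kappa> \<tau> \<mu> x a b"
proof -
  note cplD = completes_half_cycleD[OF cpl]
  let ?S = "T1 \<Delta>"
  have q: "qdiff (x t) = qdiff (profile \<Delta> (t - a))" if "t \<in> {a..b}" for t
    using that x[of t] xb qdiff_profile_len[OF cpl] b by (cases "t = b") auto
  have cont: "continuous_on {a..b} (\<lambda>t. qdiff (x t))"
    by (rule continuous_on_eq[OF continuous_on_qdiff_profile[of _ \<Delta> a]]) (simp add: q)
  have xa: "qdiff (x a) = \<Delta>" using q[of a] b cplD by (simp add: profile_0)
  have first: "\<kappa> < qdiff (x t) \<and>
           ((\<lambda>t. qdiff (x t)) has_real_derivative - (1 + \<mu>) - (1 - \<mu>) * exp (- (t - a)))
             (at t within {a..<a + ?S}) \<and>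
           z12 (x t) = 0 \<and> z21 (x t) = 1 - exp (- (t - a))" if t: "t \<in> {a..<a + ?S}" for t
  proof -
    have xt: "x s = (\<Delta> - fall \<mu> (s - a), 0, 1 - exp (- (s - a)))" if "s \<in> {a..<a + ?S}" for s
      using that x[of s] b cplD by (simp add: profile_first)
    have "((\<lambda>t. qdiff (x t)) has_real_derivative - (1 + \<mu>) - (1 - \<mu>) * exp (- (t - a)))
             (at t within {a..<a + ?S})"
    proof (rule has_field_derivative_transform_within[OF _ zero_less_one t])
      show "((\<lambda>t. \<Delta> - fall \<mu> (t - a)) has_real_derivative - (1 + \<mu>) - (1 - \<mu>) * exp (- (t - a)))
             (at t within {a..<a + ?S})"
        by (auto intro!: derivative_eq_intros)
    qed (use xt in auto)
    moreover have "fall \<mu> (t - a) < \<Delta> - \<kappa>" 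
      using t fall_T1[OF cplD(1)] fall_less_iff[of "t - a" ?S] by auto
    ultimately show ?thesis using xt[OF t] by simp
  qed
  have sign: "- (e * (d * (1 - \<mu>))) = (\<mu> - 1) * (d * e)" for d e
    by (simp add: algebra_simps)
  have second: "((\<lambda>t. qdiff (x t)) has_real_derivative - (1 - \<mu>) * z21 (x t))
             (at t within {a + ?S..<b}) \<and>
           z12 (x t) = 0 \<and>
           z21 (x t) = (1 - exp (- ?S)) * exp (- \<mu> * (t - (a + ?S)))" if t: "t \<in> {a + ?S..<b}" for t
  proof -
    have xt: "x s = (\<kappa> - (1 - \<mu>) / \<mu> * ((1 - exp (- ?S)) * (1 - exp (- \<mu> * (s - (a + ?S))))), 0,
        (1 - exp (- ?S)) * exp (- \<mu> * (s - (a + ?S))))" if "s \<in> {a + ?S..<b}" for s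
      using that x[of s] b cplD by (simp add: profile_second diff_diff_eq)
    have "((\<lambda>t. qdiff (x t)) has_real_derivative - (1 - \<mu>) * z21 (x t)) (at t within {a + ?S..<b})"
    proof (rule has_field_derivative_transform_within[OF _ zero_less_one t])
      show "((\<lambda>s. \<kappa> - (1 - \<mu>) / \<mu> * ((1 - exp (- ?S)) * (1 - exp (- \<mu> * (s - (a + ?S))))))
          has_real_derivative - (1 - \<mu>) * z21 (x t)) (at t within {a + ?S..<b})"
        using mu by (auto intro!: derivative_eq_intros simp: xt[OF t] sign)
    qed (use xt in auto)
    then show ?thesis using xt[OF t] by simp
  qed
  have hit: "qdiff (x (a + ?S)) = \<kappa>" using q[of "a + ?S"] b cplD by (simp add: profile_second)
  define S2 where "S2 = ln ((1 - exp (- ?S)) / \<tau>) / \<mu>"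
  have S2: "0 \<le> S2" "b = a + ?S + S2" using cplD b by (simp_all add: len_def S2_def)
  have start: "\<kappa> < qdiff (x a)" and zb: "z12 (x b) = 0" "z21 (x b) = 0" using xa xb cplD by auto
  show ?thesis unfolding half_cycle_def
    by (intro conjI exI[of _ ?S] exI[of _ S2])
      (rule start cplD(3) cont hit S2_def S2 zb | rule ballI, erule first | rule ballI, erule second)+
qed

section \<open>Dependence of a half cycle on its starting value\<close>

text \<open>The logarithm of \<open>1 - exp (- T\<^sub>1)\<close> enters \<open>len\<close>; this quantity is at least \<open>\<tau>\<close>, and there \<open>ln\<close>
  is \<open>1 / \<tau>\<close>-Lipschitz.\<close>

lemma len_lipschitz:
  assumes "completes_half_cycle \<Delta>" "completes_half_cycle \<Delta>'"
  shows "\<bar>len \<Delta> - len \<Delta>'\<bar> \<le> (1 + 1 / (\<tau> * \<mu>)) * \<bar>\<Delta> - \<Delta>'\<bar>"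
proof -
  note D = completes_half_cycleD[OF assms(1)] and D' = completes_half_cycleD[OF assms(2)]
  have ln: "\<bar>ln A - ln B\<bar> \<le> \<bar>A - B\<bar> / \<tau>" if "\<tau> \<le> A" "\<tau> \<le> B" for A B
  proof -
    have *: "ln A - ln B \<le> (A - B) / \<tau>" if "\<tau> \<le> B" "B \<le> A" for A B
    proof -
      have "ln A - ln B \<le> (A - B) / B" using that tau by (intro ln_diff_le) auto
      also have "\<dots> \<le> (A - B) / \<tau>" using that tau by (intro divide_left_mono) auto
      finally show ?thesis .
    qed
    have mono: "ln B \<le> ln A" if "B \<le> A" "\<tau> \<le> B" for A B :: real using that tau by simp
    show ?thesis
    proof (cases "B \<le> A")
      case True
      then show ?thesis using *[of B A] mono[of B A] that by simp
    next
      case False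
      then show ?thesis using *[of A B] mono[of A B] that by simp
    qed
  qed
  let ?A = "1 - exp (- T1 \<Delta>)" and ?B = "1 - exp (- T1 \<Delta>')"
  have "\<bar>?A - ?B\<bar> \<le> \<bar>T1 \<Delta> - T1 \<Delta>'\<bar>"
    using exp_minus_lipschitz[of 0 "T1 \<Delta>" "T1 \<Delta>'"] D D' by simp
  also have "\<dots> \<le> \<bar>\<Delta> - \<Delta>'\<bar>" using T1_lipschitz D D' by blast
  finally have AB: "\<bar>?A - ?B\<bar> \<le> \<bar>\<Delta> - \<Delta>'\<bar>" .
  have "ln (?A / \<tau>) = ln ?A - ln \<tau>" "ln (?B / \<tau>) = ln ?B - ln \<tau>"
    using D D' tau by (simp_all add: ln_div del: ln_le_cancel_iff)
  then have "len \<Delta> - len \<Delta>' = (T1 \<Delta> - T1 \<Delta>') + (ln ?A - ln ?B) / \<mu>"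
    unfolding len_def by (simp only: diff_divide_distrib)
  also have "\<bar>\<dots>\<bar> \<le> \<bar>T1 \<Delta> - T1 \<Delta>'\<bar> + \<bar>ln ?A - ln ?B\<bar> / \<mu>"
    using abs_triangle_ineq[of "T1 \<Delta> - T1 \<Delta>'" "(ln ?A - ln ?B) / \<mu>"] mu by simp
  also have "\<dots> \<le> \<bar>\<Delta> - \<Delta>'\<bar> + (\<bar>\<Delta> - \<Delta>'\<bar> / \<tau>) / \<mu>"
  proof (intro add_mono divide_right_mono)
    have "\<bar>ln ?A - ln ?B\<bar> \<le> \<bar>?A - ?B\<bar> / \<tau>" using ln D D' by blast
    also have "\<dots> \<le> \<bar>\<Delta> - \<Delta>'\<bar> / \<tau>" using AB tau by (intro divide_right_mono) auto
    finally show "\<bar>ln ?A - ln ?B\<bar> \<le> \<bar>\<Delta> - \<Delta>'\<bar> / \<tau>" .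
  qed (use T1_lipschitz D D' mu in auto)
  finally show ?thesis by (simp add: algebra_simps)
qed

lemma profile_lipschitz:
  assumes "\<kappa> < \<Delta>" "\<kappa> < \<Delta>'" "0 \<le> t" "0 \<le> t'"
  shows "dist (profile \<Delta> t) (profile \<Delta>' t') \<le> (4 + 2 / \<mu>) * (\<bar>\<Delta> - \<Delta>'\<bar> + \<bar>t - t'\<bar>)"
proof -
  let ?e = "\<bar>\<Delta> - \<Delta>'\<bar> + \<bar>t - t'\<bar>"
  have pos: "0 < T1 \<Delta>" "0 < T1 \<Delta>'" using T1_pos assms by auto
  have T: "\<bar>T1 \<Delta> - T1 \<Delta>'\<bar> \<le> \<bar>\<Delta> - \<Delta>'\<bar>" using T1_lipschitz assms by blast
  have fl: "\<bar>fall \<mu> t - fall \<mu> t'\<bar> \<le> 2 * \<bar>t - t'\<bar>" using abs_fall_diff(2) assms by blast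
  have E: "\<bar>exp (- r) - exp (- r')\<bar> \<le> \<bar>r - r'\<bar>" if "0 \<le> r" "0 \<le> r'" for r r' :: real
    using exp_minus_lipschitz[of 0 r r'] that by simp
  define A A' where "A = exp (- T1 \<Delta>)" and "A' = exp (- T1 \<Delta>')"
  define M M' where "M = exp (- min t (T1 \<Delta>))" and "M' = exp (- min t' (T1 \<Delta>'))"
  define B B' where "B = exp (- (\<mu> * max 0 (t - T1 \<Delta>)))" and "B' = exp (- (\<mu> * max 0 (t' - T1 \<Delta>')))"
  have range: "0 \<le> A" "A \<le> 1" "0 \<le> A'" "A' \<le> 1" "0 \<le> B" "B \<le> 1" "0 \<le> B'" "B' \<le> 1"
    "0 \<le> M" "M \<le> 1" "0 \<le> M'" "M' \<le> 1"
    using pos mu assms by (auto simp: A_def A'_def B_def B'_def M_def M'_def)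
  have dA: "\<bar>A - A'\<bar> \<le> ?e" using E[of "T1 \<Delta>" "T1 \<Delta>'"] pos T by (simp add: A_def A'_def)
  have dM: "\<bar>M - M'\<bar> \<le> ?e"
    using E[of "min t (T1 \<Delta>)" "min t' (T1 \<Delta>')"] pos T assms unfolding M_def M'_def by linarith
  have "\<bar>B - B'\<bar> \<le> \<mu> * \<bar>max 0 (t - T1 \<Delta>) - max 0 (t' - T1 \<Delta>')\<bar>"
    using E[of "\<mu> * max 0 (t - T1 \<Delta>)" "\<mu> * max 0 (t' - T1 \<Delta>')"] mu
    by (simp add: B_def B'_def abs_mult flip: right_diff_distrib)
  also have "\<dots> \<le> 1 * ?e" using T mu by (intro mult_mono) auto
  finally have dB: "\<bar>B - B'\<bar> \<le> ?e" by simp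
  have P: "\<bar>(1 - A) * (1 - B) - (1 - A') * (1 - B')\<bar> \<le> 2 * ?e"
    using abs_mult_diff_le[of "1 - A'" "1 - B" "1 - A" "1 - B'"] range dA dB
    by (simp add: abs_minus_commute)
  have Q: "\<bar>(1 - M) * B - (1 - M') * B'\<bar> \<le> 2 * ?e"
    using abs_mult_diff_le[of "1 - M'" B "1 - M" B'] range dM dB
    by (simp add: abs_minus_commute)
  define G where "G = max 0 (\<Delta> - \<kappa> - fall \<mu> t) - max 0 (\<Delta>' - \<kappa> - fall \<mu> t')"
  have "\<bar>G\<bar> \<le> \<bar>(\<Delta> - \<Delta>') - (fall \<mu> t - fall \<mu> t')\<bar>" unfolding G_def by linarith
  also have "\<dots> \<le> \<bar>\<Delta> - \<Delta>'\<bar> + 2 * \<bar>t - t'\<bar>"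
    using fl abs_triangle_ineq4[of "\<Delta> - \<Delta>'" "fall \<mu> t - fall \<mu> t'"] by simp
  finally have G: "\<bar>G\<bar> \<le> 2 * ?e" by (rule order_trans) (simp add: algebra_simps)
  define R where "R = (1 - \<mu>) / \<mu> * ((1 - A) * (1 - B) - (1 - A') * (1 - B'))"
  have "\<bar>R\<bar> = (1 - \<mu>) / \<mu> * \<bar>(1 - A) * (1 - B) - (1 - A') * (1 - B')\<bar>"
    using mu by (simp add: R_def abs_mult)
  also have "\<dots> \<le> 1 / \<mu> * (2 * ?e)"
    using mu P by (intro mult_mono divide_right_mono) auto
  finally have R: "\<bar>R\<bar> \<le> 2 / \<mu> * ?e" by simp
  have "dist (profile \<Delta> t) (profile \<Delta>' t') = sqrt ((G - R)\<^sup>2 + ((1 - M) * B - (1 - M') * B')\<^sup>2)"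
    by (simp add: profile_def dist_Pair_Pair dist_real_def G_def R_def A_def A'_def B_def B'_def
        M_def M'_def algebra_simps)
  also have "\<dots> \<le> \<bar>G - R\<bar> + \<bar>(1 - M) * B - (1 - M') * B'\<bar>" by (rule sqrt_sum_squares_le_sum_abs)
  also have "\<dots> \<le> (2 * ?e + 2 / \<mu> * ?e) + 2 * ?e" using G R Q by linarith
  finally show ?thesis by (simp add: algebra_simps)
qed

text \<open>Stretching a half cycle onto another one moves no time by more than the difference of the two
  lengths, so at matched times the two profiles are as close as the starting values, up to a
  constant factor.\<close>

lemma half_cycle_matching:
  assumes "completes_half_cycle \<Delta>" "completes_half_cycle \<Delta>'" "s \<in> {0..len \<Delta>'}"
  shows "\<bar>s * (len \<Delta> / len \<Delta>') - s\<bar> \<le> (1 + 1 / (\<tau> * \<mu>)) * \<bar>\<Delta> - \<Delta>'\<bar>"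
    and "dist (profile \<Delta> (s * (len \<Delta> / len \<Delta>'))) (profile \<Delta>' s)
      \<le> (4 + 2 / \<mu>) * (2 + 1 / (\<tau> * \<mu>)) * \<bar>\<Delta> - \<Delta>'\<bar>"
proof -
  note D = completes_half_cycleD[OF assms(1)] and D' = completes_half_cycleD[OF assms(2)]
  have "s * (len \<Delta> / len \<Delta>') - s = s / len \<Delta>' * (len \<Delta> - len \<Delta>')"
    using D'(5) by (simp add: field_simps)
  then have "\<bar>s * (len \<Delta> / len \<Delta>') - s\<bar> = s / len \<Delta>' * \<bar>len \<Delta> - len \<Delta>'\<bar>"
    using assms(3) D'(5) by (simp add: abs_mult)
  also have "\<dots> \<le> 1 * \<bar>len \<Delta> - len \<Delta>'\<bar>"
    using assms(3) D'(5) by (intro mult_right_mono) auto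
  finally show *: "\<bar>s * (len \<Delta> / len \<Delta>') - s\<bar> \<le> (1 + 1 / (\<tau> * \<mu>)) * \<bar>\<Delta> - \<Delta>'\<bar>"
    using len_lipschitz[OF assms(1,2)] by simp
  have "dist (profile \<Delta> (s * (len \<Delta> / len \<Delta>'))) (profile \<Delta>' s)
      \<le> (4 + 2 / \<mu>) * (\<bar>\<Delta> - \<Delta>'\<bar> + \<bar>s * (len \<Delta> / len \<Delta>') - s\<bar>)"
    using assms(3) D D' by (intro profile_lipschitz) auto
  also have "\<dots> \<le> (4 + 2 / \<mu>) * ((2 + 1 / (\<tau> * \<mu>)) * \<bar>\<Delta> - \<Delta>'\<bar>)"
    using * mu by (intro mult_left_mono) (auto simp: algebra_simps)
  finally show "dist (profile \<Delta> (s * (len \<Delta> / len \<Delta>'))) (profile \<Delta>' s)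
      \<le> (4 + 2 / \<mu>) * (2 + 1 / (\<tau> * \<mu>)) * \<bar>\<Delta> - \<Delta>'\<bar>" by (simp only: mult.assoc)
qed

end

section \<open>Solutions as orbits of a contraction\<close>

text \<open>\<open>S\<close> stands for the interval \<open>S_mu\<close>, which has these properties once \<open>\<mu>\<close> is small enough for the
  given \<open>\<rho>\<close>.\<close>

locale contracting_system = approximating_system +
  fixes S :: "real set" and \<rho> :: real
  assumes rho: "0 < \<rho>" "\<rho> < 1"
    and S: "closed S" "S \<noteq> {}"
    and maps: "\<Delta> \<in> S \<Longrightarrow> Tmap \<kappa> \<tau> \<mu> \<Delta> \<in> S"
    and completes: "\<Delta> \<in> S \<Longrightarrow> completes_half_cycle \<Delta>"
    and contraction: "\<Delta> \<in> S \<Longrightarrow> \<Delta>' \<in> S \<Longrightarrow>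
      \<bar>Tmap \<kappa> \<tau> \<mu> \<Delta> - Tmap \<kappa> \<tau> \<mu> \<Delta>'\<bar> \<le> \<rho> * \<bar>\<Delta> - \<Delta>'\<bar>"
begin

definition iter :: "real \<Rightarrow> nat \<Rightarrow> real" where
  "iter \<Delta> k = (Tmap \<kappa> \<tau> \<mu> ^^ k) \<Delta>"

definition start :: "real \<Rightarrow> nat \<Rightarrow> real" where
  "start \<Delta> k = (\<Sum>j<k. len (iter \<Delta> j))"

definition traces :: "real \<Rightarrow> (real \<Rightarrow> state) \<Rightarrow> bool" where
  "traces \<Delta> x \<longleftrightarrow> (\<forall>k. \<forall>t\<in>{start \<Delta> k..<start \<Delta> (Suc k)}.
     x t = (swap_labels ^^ k) (profile (iter \<Delta> k) (t - start \<Delta> k)))"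

lemma iter_simps [simp]:
  "iter \<Delta> 0 = \<Delta>" "iter \<Delta> (Suc k) = Tmap \<kappa> \<tau> \<mu> (iter \<Delta> k)"
  by (simp_all add: iter_def)

lemma start_simps [simp]:
  "start \<Delta> 0 = 0" "start \<Delta> (Suc k) = start \<Delta> k + len (iter \<Delta> k)"
  by (simp_all add: start_def)

lemma iter_in: "\<Delta> \<in> S \<Longrightarrow> iter \<Delta> k \<in> S"
  by (induction k) (auto intro: maps)

lemma iter_gt: "\<Delta> \<in> S \<Longrightarrow> \<kappa> < iter \<Delta> k"
  using completes_half_cycleD(1) completes iter_in by blast

lemma len_pos: "\<Delta> \<in> S \<Longrightarrow> 0 < len (iter \<Delta> k)"
  using completes_half_cycleD(5) completes iter_in by blast

lemma strict_mono_start: "\<Delta> \<in> S \<Longrightarrow> strict_mono (start \<Delta>)"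
  by (intro strict_monoI_Suc) (simp add: len_pos)

text \<open>Half cycle times cannot accumulate: within a half cycle \<open>z\<^sub>2\<^sub>1\<close> has to rise from 0 to at least \<open>\<tau>\<close>,
  which takes at least \<open>- ln (1 - \<tau>)\<close>.\<close>

lemma filterlim_start:
  assumes "\<Delta> \<in> S"
  shows "filterlim (start \<Delta>) at_top sequentially"
proof -
  have "0 < - ln (1 - \<tau>)" using tau by simp
  then have lim: "filterlim (\<lambda>k. real k * - ln (1 - \<tau>)) at_top sequentially" by real_asymp
  have "real k * - ln (1 - \<tau>) \<le> start \<Delta> k" for k
  proof (induction k)
    case (Suc k)
    then show ?case
      using completes_half_cycleD(6)[OF completes[OF iter_in[OF assms, of k]]]
      by (simp add: algebra_simps)
  qed simp
  then have "\<forall>\<^sub>F k in sequentially. real k * - ln (1 - \<tau>) \<le> start \<Delta> k"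
    by (intro always_eventually allI)
  with lim show ?thesis by (rule filterlim_at_top_mono)
qed

lemma half_cycle_at:
  assumes "\<Delta> \<in> S" "0 \<le> t"
  obtains k where "t \<in> {start \<Delta> k..<start \<Delta> (Suc k)}"
proof -
  have "\<forall>\<^sub>F k in sequentially. t < start \<Delta> k"
    using filterlim_start[OF assms(1)] by (simp add: filterlim_at_top_dense)
  then have ex: "\<exists>k. t < start \<Delta> k" using eventually_happens trivial_limit_sequentially by blast
  define n where "n = (LEAST k. t < start \<Delta> k)"
  have n: "t < start \<Delta> n" unfolding n_def using ex by (rule LeastI_ex)
  then obtain k where k: "n = Suc k" using assms(2) by (cases n) auto
  then have "\<not> t < start \<Delta> k" using not_less_Least[of k "\<lambda>k. t < start \<Delta> k"] by (simp add: n_def)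
  then show ?thesis using that[of k] n k by simp
qed

lemma traces_start:
  assumes "\<Delta> \<in> S" "traces \<Delta> x"
  shows "x (start \<Delta> k) = (swap_labels ^^ k) (iter \<Delta> k, 0, 0)"
proof -
  have "start \<Delta> k \<in> {start \<Delta> k..<start \<Delta> (Suc k)}" using len_pos[OF assms(1)] by simp
  then have "x (start \<Delta> k) = (swap_labels ^^ k) (profile (iter \<Delta> k) (start \<Delta> k - start \<Delta> k))"
    using assms(2) unfolding traces_def by blast
  then show ?thesis using profile_0[OF iter_gt[OF assms(1)]] by simp
qed

lemma ex_traces:
  assumes "\<Delta> \<in> S"
  obtains x where "traces \<Delta> x"
proof -
  define K where "K t = (LEAST k. t < start \<Delta> (Suc k))" for t
  have "K t = k" if t: "t \<in> {start \<Delta> k..<start \<Delta> (Suc k)}" for t k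
    unfolding K_def
  proof (rule Least_equality)
    fix j assume j: "t < start \<Delta> (Suc j)"
    show "k \<le> j"
    proof (rule ccontr)
      assume "\<not> k \<le> j"
      then have "start \<Delta> (Suc j) \<le> start \<Delta> k"
        using strict_mono_less_eq[OF strict_mono_start[OF assms]] by (metis not_less_eq_eq)
      then show False using t j by (auto simp del: start_simps)
    qed
  qed (use t in auto)
  then have "traces \<Delta> (\<lambda>t. (swap_labels ^^ K t) (profile (iter \<Delta> (K t)) (t - start \<Delta> (K t))))"
    unfolding traces_def by simp
  then show ?thesis by (rule that)
qed

lemma traces_unique:
  assumes "\<Delta> \<in> S" "traces \<Delta> x" "traces \<Delta> y" "0 \<le> t"
  shows "x t = y t"
  using half_cycle_at[OF assms(1,4)] assms(2,3) unfolding traces_def by metis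

text \<open>Each half cycle is determined by its starting value and hands the relabelled value
  \<open>\<T> \<Delta>\<close> on to the next, so induction over the half cycles fixes both the times \<open>\<sigma>\<close> and the path.\<close>

lemma approx_solution_iff:
  assumes S: "\<Delta> \<in> S"
  shows "approx_solution \<kappa> \<tau> \<mu> \<Delta> \<sigma> x \<longleftrightarrow> \<sigma> = start \<Delta> \<and> traces \<Delta> x"
proof (intro iffI conjI)
  assume sol: "approx_solution \<kappa> \<tau> \<mu> \<Delta> \<sigma> x"
  then have x0: "x 0 = (\<Delta>, 0, 0)" "\<sigma> 0 = 0"
    and hc: "\<And>k. half_cycle \<kappa> \<tau> \<mu> (\<lambda>t. (swap_labels ^^ k) (x t)) (\<sigma> k) (\<sigma> (Suc k))"
    unfolding approx_solution_def by auto
  have *: "\<sigma> k = start \<Delta> k \<and> (swap_labels ^^ k) (x (\<sigma> k)) = (iter \<Delta> k, 0, 0)" for k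
  proof (induction k)
    case (Suc k)
    then have "qdiff ((swap_labels ^^ k) (x (\<sigma> k))) = iter \<Delta> k" by (metis fst_conv)
    note hc' = half_cycle_imp_profile(2,4)[OF hc[of k], unfolded this]
    have "(swap_labels ^^ Suc k) (x (\<sigma> (Suc k))) = (iter \<Delta> (Suc k), 0, 0)"
      using hc'(2) by simp
    then show ?case using hc'(1) Suc by simp
  qed (simp add: x0)
  then show sigma: "\<sigma> = start \<Delta>" by blast
  have "(swap_labels ^^ k) (x t) = profile (iter \<Delta> k) (t - start \<Delta> k)"
    if "t \<in> {start \<Delta> k..<start \<Delta> (Suc k)}" for k t
    using half_cycle_imp_profile(3)[OF hc[of k], of t] * that sigma by simp
  then show "traces \<Delta> x" unfolding traces_def swap_labels_pow_eq_iff[symmetric] by auto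
next
  assume "\<sigma> = start \<Delta> \<and> traces \<Delta> x"
  then have sigma: "\<sigma> = start \<Delta>" and x: "traces \<Delta> x" by auto
  have "half_cycle \<kappa> \<tau> \<mu> (\<lambda>t. (swap_labels ^^ k) (x t)) (start \<Delta> k) (start \<Delta> (Suc k))" for k
  proof (rule half_cycle_profile)
    show "completes_half_cycle (iter \<Delta> k)" using completes iter_in S by blast
    show "(swap_labels ^^ k) (x t) = profile (iter \<Delta> k) (t - start \<Delta> k)"
      if "t \<in> {start \<Delta> k..<start \<Delta> (Suc k)}" for t
      using x that unfolding traces_def by simp
    show "(swap_labels ^^ k) (x (start \<Delta> (Suc k))) = (- Tmap \<kappa> \<tau> \<mu> (iter \<Delta> k), 0, 0)"
      unfolding traces_start[OF S x] swap_labels_pow_queue by (simp flip: power_add mult.assoc)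
  qed simp
  then show "approx_solution \<kappa> \<tau> \<mu> \<Delta> \<sigma> x"
    using traces_start[OF S x, of 0] filterlim_start[OF S]
    unfolding approx_solution_def sigma by simp
qed

lemma iter_contraction:
  assumes "\<Delta> \<in> S" "\<Delta>' \<in> S"
  shows "\<bar>iter \<Delta> k - iter \<Delta>' k\<bar> \<le> \<rho> ^ k * \<bar>\<Delta> - \<Delta>'\<bar>"
proof (induction k)
  case (Suc k)
  have "\<bar>iter \<Delta> (Suc k) - iter \<Delta>' (Suc k)\<bar> \<le> \<rho> * \<bar>iter \<Delta> k - iter \<Delta>' k\<bar>"
    using contraction iter_in assms by simp
  also have "\<dots> \<le> \<rho> * (\<rho> ^ k * \<bar>\<Delta> - \<Delta>'\<bar>)" using Suc rho by (intro mult_left_mono) auto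
  finally show ?case by (simp add: mult.assoc)
qed simp

lemma ex_fixed_point:
  obtains \<Delta>s where "\<Delta>s \<in> S" "Tmap \<kappa> \<tau> \<mu> \<Delta>s = \<Delta>s"
proof -
  have "\<exists>!\<Delta>. \<Delta> \<in> S \<and> Tmap \<kappa> \<tau> \<mu> \<Delta> = \<Delta>"
    using S rho maps contraction
    by (intro Banach_fix[of S \<rho>]) (auto simp: complete_eq_closed dist_real_def)
  then show ?thesis using that by blast
qed

end

section \<open>The periodic equilibrium\<close>

locale system_with_fixed_point = contracting_system +
  fixes \<Delta>s :: real
  assumes fixed_in: "\<Delta>s \<in> S" and fixed: "Tmap \<kappa> \<tau> \<mu> \<Delta>s = \<Delta>s"
begin

declare fixed [simp]

lemma iter_fixed [simp]: "iter \<Delta>s k = \<Delta>s"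
  by (induction k) auto

lemma start_fixed: "start \<Delta>s k = real k * len \<Delta>s"
  by (simp add: start_def)

text \<open>The a priori estimate of Banach's theorem: the distance to the fixed point is controlled by the
  first step, as \<open>(1 - \<rho>) * \<bar>\<Delta> - \<Delta>s\<bar> \<le> \<bar>\<T> \<Delta> - \<Delta>\<bar>\<close>.\<close>

lemma iter_error:
  assumes "\<Delta> \<in> S"
  shows "\<bar>iter \<Delta> k - \<Delta>s\<bar> \<le> \<rho> ^ k / (1 - \<rho>) * \<bar>iter \<Delta> 1 - \<Delta>\<bar>"
proof -
  have "\<bar>iter \<Delta> 1 - \<Delta>s\<bar> \<le> \<rho> * \<bar>\<Delta> - \<Delta>s\<bar>"
    using iter_contraction[OF assms fixed_in, of 1] by simp
  then have "(1 - \<rho>) * \<bar>\<Delta> - \<Delta>s\<bar> \<le> \<bar>iter \<Delta> 1 - \<Delta>\<bar>" by (simp add: algebra_simps)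
  then have "\<bar>\<Delta> - \<Delta>s\<bar> \<le> \<bar>iter \<Delta> 1 - \<Delta>\<bar> / (1 - \<rho>)" using rho by (simp add: field_simps)
  then have "\<rho> ^ k * \<bar>\<Delta> - \<Delta>s\<bar> \<le> \<rho> ^ k * (\<bar>iter \<Delta> 1 - \<Delta>\<bar> / (1 - \<rho>))"
    using rho by (intro mult_left_mono) auto
  then show ?thesis using iter_contraction[OF assms fixed_in, of k] by simp
qed

lemma traces_periodic:
  assumes "traces \<Delta>s u" "0 \<le> t"
  shows "u (t + start \<Delta>s 2) = u t"
proof -
  obtain k where k: "t \<in> {start \<Delta>s k..<start \<Delta>s (Suc k)}" using half_cycle_at[OF fixed_in assms(2)] .
  have "t + start \<Delta>s 2 \<in> {start \<Delta>s (k + 2)..<start \<Delta>s (Suc (k + 2))}"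
    using k by (simp add: start_fixed algebra_simps)
  then have "u (t + start \<Delta>s 2) = (swap_labels ^^ (k + 2)) (profile \<Delta>s (t + start \<Delta>s 2 - start \<Delta>s (k + 2)))"
    using assms(1) unfolding traces_def by (metis iter_fixed)
  also have "t + start \<Delta>s 2 - start \<Delta>s (k + 2) = t - start \<Delta>s k"
    by (simp add: start_fixed algebra_simps)
  also have "(swap_labels ^^ (k + 2)) (profile \<Delta>s (t - start \<Delta>s k)) = u t"
    using assms(1) k unfolding traces_def by (simp add: numeral_2_eq_2)
  finally show ?thesis .
qed

lemma traces_nonconstant_periodic:
  assumes "traces \<Delta>s u"
  shows "nonconstant_periodic u"
proof -
  have L: "0 < len \<Delta>s" using len_pos[OF fixed_in, of 0] by simp
  have "u 0 = (\<Delta>s, 0, 0)" "u (len \<Delta>s) = (- \<Delta>s, 0, 0)"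
    using traces_start[OF fixed_in assms, of 0] traces_start[OF fixed_in assms, of 1]
    by auto
  moreover have "0 < \<Delta>s" using iter_gt[OF fixed_in, of 0] kappa by simp
  ultimately have "u 0 \<noteq> u (len \<Delta>s)" by simp
  moreover have "0 < start \<Delta>s 2" using L by (simp add: start_fixed)
  ultimately show ?thesis
    using traces_periodic[OF assms] L unfolding nonconstant_periodic_def
    by (intro conjI exI[of _ "start \<Delta>s 2"] exI[of _ 0] exI[of _ "len \<Delta>s"]) auto
qed

text \<open>The period is not assumed to be a cycle. But the initial state has \<open>z\<^sub>2\<^sub>1 = 0\<close>, so it can recur only
  at the start of a half cycle, and as the queue difference is positive again the number of half
  cycles is even. Hence \<open>\<Delta>\<close> is a fixed point of some iterate of \<open>\<T>\<close>, and iterates of a contraction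
  have no fixed points beyond those of the map itself.\<close>

lemma periodic_starts_at_fixed_point:
  assumes "\<Delta> \<in> S" "traces \<Delta> u" "0 < P" "u P = u 0"
  shows "\<Delta> = \<Delta>s"
proof -
  obtain k where k: "P \<in> {start \<Delta> k..<start \<Delta> (Suc k)}"
    using half_cycle_at[OF assms(1), of P] assms(3) by auto
  have u0: "u 0 = (\<Delta>, 0, 0)" using traces_start[OF assms(1,2), of 0] by simp
  have "u P = (swap_labels ^^ k) (profile (iter \<Delta> k) (P - start \<Delta> k))"
    using assms(2) k unfolding traces_def by blast
  then have pr: "profile (iter \<Delta> k) (P - start \<Delta> k) = ((- 1) ^ k * \<Delta>, 0, 0)"
    using u0 assms(4) swap_labels_pow_eq_iff swap_labels_pow_queue by metis
  have P: "P = start \<Delta> k"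
    using z21_profile_pos[OF iter_gt[OF assms(1)], of "P - start \<Delta> k" k] pr k by (cases "P = start \<Delta> k") auto
  then have "k \<noteq> 0" using assms(3) by (cases k) auto
  have eq: "iter \<Delta> k = (- 1) ^ k * \<Delta>" using pr P profile_0[OF iter_gt[OF assms(1)]] by simp
  moreover have "0 < iter \<Delta> k" "0 < \<Delta>"
    using iter_gt[OF assms(1), of k] iter_gt[OF assms(1), of 0] kappa by auto
  ultimately have "iter \<Delta> k = \<Delta>" by (cases "even k") auto
  then have "\<bar>\<Delta> - \<Delta>s\<bar> \<le> \<rho> ^ k * \<bar>\<Delta> - \<Delta>s\<bar>"
    using iter_contraction[OF assms(1) fixed_in, of k] by simp
  moreover have "\<rho> ^ k < 1" using rho \<open>k \<noteq> 0\<close> by (simp add: power_less_one_iff)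
  ultimately show ?thesis
    using mult_strict_right_mono[of "\<rho> ^ k" 1 "\<bar>\<Delta> - \<Delta>s\<bar>"] by (cases "\<Delta> = \<Delta>s") auto
qed

section \<open>Convergence of the paths\<close>

text \<open>Both half cycles of a cycle are matched affinely with those of the equilibrium, so that the jumps
  of the two paths correspond to each other. The constant \<open>C\<close> counts the time shift twice: in the
  second half cycle the error of the first half cycle's length adds to its own.\<close>

lemma traces_converge:
  assumes D: "\<Delta> \<in> S" and x: "traces \<Delta> x" and u: "traces \<Delta>s u"
  shows "cycles_converge_geometrically (\<rho>\<^sup>2) (start \<Delta>) x (start \<Delta>s) u"
proof -
  define \<Sigma> where "\<Sigma> = len \<Delta>s"
  define K1 where "K1 = 1 + 1 / (\<tau> * \<mu>)"
  define K2 where "K2 = (4 + 2 / \<mu>) * (2 + 1 / (\<tau> * \<mu>))"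
  define C where "C = (2 * K1 + K2) * \<bar>\<Delta> - \<Delta>s\<bar>"
  have K: "0 \<le> K1" "0 \<le> K2" using tau mu by (auto simp: K1_def K2_def)
  have Sig: "0 < \<Sigma>" using len_pos[OF fixed_in, of 0] by (simp add: \<Sigma>_def)
  have period: "start \<Delta>s 2 = 2 * \<Sigma>" by (simp add: start_fixed \<Sigma>_def)
  have cpl: "completes_half_cycle (iter \<Delta> k)" for k using completes iter_in D by blast
  have cpls: "completes_half_cycle \<Delta>s" using completes fixed_in by blast
  have time: "\<bar>s * (len (iter \<Delta> k) / \<Sigma>) - s\<bar> \<le> K1 * \<bar>iter \<Delta> k - \<Delta>s\<bar>" if "s \<in> {0..\<Sigma>}" for s k
    using half_cycle_matching(1)[OF cpl cpls] that by (simp add: \<Sigma>_def K1_def)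
  have space: "dist (x (start \<Delta> k + s * (len (iter \<Delta> k) / \<Sigma>)))
      ((swap_labels ^^ k) (profile \<Delta>s s)) \<le> K2 * \<bar>iter \<Delta> k - \<Delta>s\<bar>" if s: "s \<in> {0..<\<Sigma>}" for s k
  proof -
    have "s * (len (iter \<Delta> k) / \<Sigma>) < \<Sigma> * (len (iter \<Delta> k) / \<Sigma>)"
      using s Sig len_pos[OF D, of k] by (intro mult_strict_right_mono) auto
    then have "start \<Delta> k + s * (len (iter \<Delta> k) / \<Sigma>) \<in> {start \<Delta> k..<start \<Delta> (Suc k)}"
      using s Sig len_pos[OF D, of k] by auto
    then have "x (start \<Delta> k + s * (len (iter \<Delta> k) / \<Sigma>)) =
        (swap_labels ^^ k) (profile (iter \<Delta> k) (s * (len (iter \<Delta> k) / \<Sigma>)))"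
      using x unfolding traces_def by (metis add_diff_cancel_left')
    then show ?thesis
      using half_cycle_matching(2)[OF cpl cpls, of s k] s
      by (simp add: dist_swap_labels_pow \<Sigma>_def K2_def)
  qed
  have u_half: "u (real k * \<Sigma> + s) = (swap_labels ^^ k) (profile \<Delta>s s)" if "s \<in> {0..<\<Sigma>}" for k s
    using u that unfolding traces_def \<Sigma>_def
    by (metis (no_types, lifting) add.commute add_diff_cancel_left' add_less_cancel_left
        atLeastLessThan_iff iter_fixed le_add_same_cancel1 start_fixed start_simps(2))
  have "\<exists>\<theta>. strict_mono_on {0..start \<Delta>s 2} \<theta> \<and>
      \<theta> ` {0..start \<Delta>s 2} = {start \<Delta> (2 * n)..start \<Delta> (2 * n + 2)} \<and>
      (\<forall>s\<in>{0..start \<Delta>s 2}. \<bar>\<theta> s - (start \<Delta> (2 * n) + s)\<bar> \<le> C * (\<rho>\<^sup>2) ^ n \<and>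
         dist (x (\<theta> s)) (u s) \<le> C * (\<rho>\<^sup>2) ^ n)" for n
  proof -
    define a L L' where "a = start \<Delta> (2 * n)" and "L = len (iter \<Delta> (2 * n))"
      and "L' = len (iter \<Delta> (Suc (2 * n)))"
    define \<theta> where "\<theta> = (\<lambda>s. if s < \<Sigma> then a + s * (L / \<Sigma>) else a + L + (s - \<Sigma>) * (L' / \<Sigma>))"
    define e where "e = \<rho> ^ (2 * n) * \<bar>\<Delta> - \<Delta>s\<bar>"
    have e: "\<bar>iter \<Delta> k - \<Delta>s\<bar> \<le> e" if "2 * n \<le> k" for k
    proof -
      have "\<bar>iter \<Delta> k - \<Delta>s\<bar> \<le> \<rho> ^ k * \<bar>\<Delta> - \<Delta>s\<bar>" using iter_contraction[OF D fixed_in, of k] by simp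
      also have "\<dots> \<le> e" unfolding e_def
        using rho that by (intro mult_right_mono power_decreasing) auto
      finally show ?thesis .
    qed
    have "0 \<le> e" using e[of "2 * n"] by linarith
    have C: "C * (\<rho>\<^sup>2) ^ n = 2 * (K1 * e) + K2 * e"
      by (simp add: C_def e_def algebra_simps flip: power_mult)
    have le1: "K1 * \<bar>iter \<Delta> k - \<Delta>s\<bar> \<le> K1 * e" and le2: "K2 * \<bar>iter \<Delta> k - \<Delta>s\<bar> \<le> K2 * e"
      if "2 * n \<le> k" for k using e[OF that] K by (auto intro: mult_left_mono)
    have Ke: "0 \<le> K1 * e" "0 \<le> K2 * e" using K \<open>0 \<le> e\<close> by auto
    have L: "0 < L" "0 < L'" unfolding L_def L'_def using len_pos[OF D] by blast+
    have ends: "start \<Delta> (Suc (2 * n)) = a + L" "start \<Delta> (2 * n + 2) = a + L + L'"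
      by (simp_all add: a_def L_def L'_def)
    have "\<bar>\<theta> s - (a + s)\<bar> \<le> C * (\<rho>\<^sup>2) ^ n \<and> dist (x (\<theta> s)) (u s) \<le> C * (\<rho>\<^sup>2) ^ n"
      if s: "s \<in> {0..2 * \<Sigma>}" for s
    proof (cases "s < \<Sigma>")
      case True
      then have th: "\<theta> s = a + s * (L / \<Sigma>)" by (simp add: \<theta>_def)
      have "\<bar>s * (L / \<Sigma>) - s\<bar> \<le> K1 * e"
        using time[of s "2 * n"] le1[of "2 * n"] s True unfolding L_def by auto
      moreover have "dist (x (\<theta> s)) (u s) \<le> K2 * e"
        using space[of s "2 * n"] le2[of "2 * n"] u_half[of s 0] s True
        unfolding th L_def a_def by auto
      ultimately show ?thesis using Ke unfolding C th by auto
    next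
      case False
      then have th: "\<theta> s = a + L + (s - \<Sigma>) * (L' / \<Sigma>)" by (simp add: \<theta>_def)
      have "\<bar>L - \<Sigma>\<bar> \<le> K1 * e"
        using time[of \<Sigma> "2 * n"] le1[of "2 * n"] Sig unfolding L_def by auto
      moreover have "\<bar>(s - \<Sigma>) * (L' / \<Sigma>) - (s - \<Sigma>)\<bar> \<le> K1 * e"
        using time[of "s - \<Sigma>" "Suc (2 * n)"] le1[of "Suc (2 * n)"] s False unfolding L'_def by auto
      moreover have "\<bar>v + w\<bar> \<le> 2 * E" if "\<bar>v\<bar> \<le> E" "\<bar>w\<bar> \<le> E" for v w E :: real
        using that by linarith
      ultimately have "\<bar>(L - \<Sigma>) + ((s - \<Sigma>) * (L' / \<Sigma>) - (s - \<Sigma>))\<bar> \<le> 2 * (K1 * e)" by blast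
      moreover have "\<theta> s - (a + s) = (L - \<Sigma>) + ((s - \<Sigma>) * (L' / \<Sigma>) - (s - \<Sigma>))"
        unfolding th by simp
      ultimately have "\<bar>\<theta> s - (a + s)\<bar> \<le> 2 * (K1 * e)" by (simp only:)
      moreover have "dist (x (\<theta> s)) (u s) \<le> K2 * e"
      proof (cases "s = 2 * \<Sigma>")
        case True
        (* Here both paths have jumped, and the states are those at the start of the next cycle. *)
        have "\<theta> s = start \<Delta> (2 * n + 2)" using True Sig unfolding th ends by simp
        moreover have "2 * n + 2 = 2 * Suc n" by simp
        then have "(swap_labels ^^ (2 * n + 2)) p = p" for p by (simp only: swap_labels_pow_even)
        moreover have "u s = profile \<Delta>s 0"
          using u_half[of 0 2] True Sig by (simp add: numeral_2_eq_2)
        ultimately have "dist (x (\<theta> s)) (u s) \<le> K2 * \<bar>iter \<Delta> (2 * n + 2) - \<Delta>s\<bar>"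
          using space[of 0 "2 * n + 2"] Sig by (simp del: start_simps iter_simps add_2_eq_Suc')
        then show ?thesis using le2[of "2 * n + 2"] by linarith
      next
        case not_end: False
        then show ?thesis
          using space[of "s - \<Sigma>" "Suc (2 * n)"] le2[of "Suc (2 * n)"] u_half[of "s - \<Sigma>" 1] s False
          unfolding th ends L'_def[symmetric] by simp
      qed
      ultimately show ?thesis using Ke unfolding C by auto
    qed
    moreover note two_piece_affine[OF Sig L, of a, folded \<theta>_def]
    ultimately show ?thesis unfolding period ends(2) a_def[symmetric] by blast
  qed
  then show ?thesis unfolding cycles_converge_geometrically_def by blast
qed

end

section \<open>Small parameters\<close>

text \<open>\<open>m \<mu>\<close> is the lower bound \<open>(\<Delta> - 1 + \<mu> - \<kappa>) / (1 + \<mu>)\<close> of the hitting time, taken at the left end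
  \<open>\<Delta> = (1 - \<mu>) * g / \<mu> - \<kappa>\<close> of \<open>S_mu\<close>, with \<open>g = 1 - \<tau> - c\<close>. The first inequality makes half cycles
  complete, the second makes \<open>\<T>\<close> a contraction with constant \<open>\<rho>\<close>.\<close>

lemma eventually_small_mu:
  fixes g \<kappa> :: real
  assumes "0 < g" "0 < \<epsilon>" "0 < \<rho>"
  defines "m \<equiv> \<lambda>\<mu>. ((1 - \<mu>) * g / \<mu> - 2 * \<kappa> - 1 + \<mu>) / (1 + \<mu>)"
  shows "\<forall>\<^sub>F \<mu> in at_right 0. exp (- m \<mu>) < \<epsilon> \<and> (1 - \<mu>) / \<mu> * exp (- m \<mu>) < \<rho>"
proof (rule eventually_conj)
  have "((\<lambda>\<mu>. exp (- m \<mu>)) \<longlongrightarrow> 0) (at_right 0)" unfolding m_def using assms(1) by real_asymp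
  then show "\<forall>\<^sub>F \<mu> in at_right 0. exp (- m \<mu>) < \<epsilon>" using order_tendstoD(2) assms by blast
  have "((\<lambda>\<mu>. (1 - \<mu>) / \<mu> * exp (- m \<mu>)) \<longlongrightarrow> 0) (at_right 0)"
    unfolding m_def using assms(1) by real_asymp
  then show "\<forall>\<^sub>F \<mu> in at_right 0. (1 - \<mu>) / \<mu> * exp (- m \<mu>) < \<rho>" using order_tendstoD(2) assms by blast
qed

theorem theoremC1:
  fixes \<kappa> \<tau> c \<mu>s :: real
  assumes "0 < \<kappa>" and "0 < \<tau>" "\<tau> < 1" and "0 < c" "c < 1 - \<tau>"
    and "0 < \<mu>s" and "\<mu>s < mu_1 \<kappa> \<tau>" and "1 - \<mu>s > - ln (1 - \<tau>)"
    and "\<And>\<mu>. 0 < \<mu> \<Longrightarrow> \<mu> \<le> \<mu>s \<Longrightarrow> Delta_M \<tau> \<mu> - delta_mu \<kappa> c \<mu> > Delta_m \<kappa> \<mu>"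
    and "\<And>\<mu>. 0 < \<mu> \<Longrightarrow> \<mu> \<le> \<mu>s \<Longrightarrow> Tmap \<kappa> \<tau> \<mu> ` S_mu \<kappa> \<tau> c \<mu> \<subseteq> S_mu \<kappa> \<tau> c \<mu>"
  shows "\<forall>\<rho>::real. 0 < \<rho> \<and> \<rho> < 1 \<longrightarrow> (\<exists>\<mu>ss. 0 < \<mu>ss \<and> \<mu>ss \<le> \<mu>s \<and>
     (\<forall>\<mu>. 0 < \<mu> \<and> \<mu> \<le> \<mu>ss \<longrightarrow>
       (\<exists>\<Delta>s \<sigma>s us.
          periodic_equilibrium_from \<kappa> \<tau> c \<mu> \<Delta>s \<sigma>s us \<and>
          (\<forall>t\<ge>0. us (t + \<sigma>s 2) = us t) \<and>
          (\<forall>\<Delta>' \<sigma>' u'. periodic_equilibrium_from \<kappa> \<tau> c \<mu> \<Delta>' \<sigma>' u' \<longrightarrow>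
             \<Delta>' = \<Delta>s \<and> (\<forall>t\<ge>0. u' t = us t)) \<and>
          (\<forall>\<Delta>0 \<in> S_mu \<kappa> \<tau> c \<mu>.
             (\<forall>k. let \<Delta> = (\<lambda>j. (Tmap \<kappa> \<tau> \<mu> ^^ j) \<Delta>0) in
                \<bar>\<Delta> k - \<Delta>s\<bar> \<le> \<rho> ^ k / (1 - \<rho>) * \<bar>\<Delta> 1 - \<Delta> 0\<bar> \<and>
                \<rho> ^ k / (1 - \<rho>) * \<bar>\<Delta> 1 - \<Delta> 0\<bar> \<le> delta_mu \<kappa> c \<mu> * (\<rho> ^ k / (1 - \<rho>))) \<and>
             (\<exists>\<sigma> x. approx_solution \<kappa> \<tau> \<mu> \<Delta>0 \<sigma> x) \<and>
             (\<forall>\<sigma> x. approx_solution \<kappa> \<tau> \<mu> \<Delta>0 \<sigma> x \<longrightarrow>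
                cycles_converge_geometrically (\<rho>\<^sup>2) \<sigma> x \<sigma>s us)))))"
proof (intro allI impI)
  fix \<rho> :: real assume \<rho>: "0 < \<rho> \<and> \<rho> < 1"
  define m where "m = (\<lambda>\<mu>. ((1 - \<mu>) * (1 - \<tau> - c) / \<mu> - 2 * \<kappa> - 1 + \<mu>) / (1 + \<mu>))"
  have "\<forall>\<^sub>F \<mu> in at_right 0. exp (- m \<mu>) < 1 - \<tau> \<and> (1 - \<mu>) / \<mu> * exp (- m \<mu>) < \<rho>"
    unfolding m_def by (rule eventually_small_mu) (use assms \<rho> in auto)
  then obtain b where b: "0 < b"
    "\<And>\<mu>. 0 < \<mu> \<Longrightarrow> \<mu> < b \<Longrightarrow> exp (- m \<mu>) < 1 - \<tau> \<and> (1 - \<mu>) / \<mu> * exp (- m \<mu>) < \<rho>"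
    unfolding eventually_at_right_field by auto
  have "\<mu>s < 1"
  proof -
    have "ln (1 - \<tau>) < 0" using assms(2,3) by simp
    then show ?thesis using assms(8) by linarith
  qed
  show "\<exists>\<mu>ss. 0 < \<mu>ss \<and> \<mu>ss \<le> \<mu>s \<and>
     (\<forall>\<mu>. 0 < \<mu> \<and> \<mu> \<le> \<mu>ss \<longrightarrow>
       (\<exists>\<Delta>s \<sigma>s us.
          periodic_equilibrium_from \<kappa> \<tau> c \<mu> \<Delta>s \<sigma>s us \<and>
          (\<forall>t\<ge>0. us (t + \<sigma>s 2) = us t) \<and>
          (\<forall>\<Delta>' \<sigma>' u'. periodic_equilibrium_from \<kappa> \<tau> c \<mu> \<Delta>' \<sigma>' u' \<longrightarrow>
             \<Delta>' = \<Delta>s \<and> (\<forall>t\<ge>0. u' t = us t)) \<and>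
          (\<forall>\<Delta>0 \<in> S_mu \<kappa> \<tau> c \<mu>.
             (\<forall>k. let \<Delta> = (\<lambda>j. (Tmap \<kappa> \<tau> \<mu> ^^ j) \<Delta>0) in
                \<bar>\<Delta> k - \<Delta>s\<bar> \<le> \<rho> ^ k / (1 - \<rho>) * \<bar>\<Delta> 1 - \<Delta> 0\<bar> \<and>
                \<rho> ^ k / (1 - \<rho>) * \<bar>\<Delta> 1 - \<Delta> 0\<bar> \<le> delta_mu \<kappa> c \<mu> * (\<rho> ^ k / (1 - \<rho>))) \<and>
             (\<exists>\<sigma> x. approx_solution \<kappa> \<tau> \<mu> \<Delta>0 \<sigma> x) \<and>
             (\<forall>\<sigma> x. approx_solution \<kappa> \<tau> \<mu> \<Delta>0 \<sigma> x \<longrightarrow>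
                cycles_converge_geometrically (\<rho>\<^sup>2) \<sigma> x \<sigma>s us))))"
    (is "\<exists>\<mu>ss. _ \<and> _ \<and> (\<forall>\<mu>. _ \<longrightarrow> ?claim \<mu>)")
    \<comment> \<open>\<open>b / 2\<close> rather than \<open>b\<close>, since the bounds hold strictly below \<open>b\<close>.\<close>
  proof (rule exI[of _ "min \<mu>s (b / 2)"], intro conjI allI impI)
    fix \<mu> assume \<mu>: "0 < \<mu> \<and> \<mu> \<le> min \<mu>s (b / 2)"
    let ?S = "S_mu \<kappa> \<tau> c \<mu>"
    have small: "exp (- m \<mu>) < 1 - \<tau>" "(1 - \<mu>) / \<mu> * exp (- m \<mu>) < \<rho>" using b \<mu> by auto
    interpret approximating_system \<kappa> \<tau> \<mu>
      using assms(1-3) \<mu> \<open>\<mu>s < 1\<close> by unfold_locales auto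
    have gt: "\<kappa> < \<Delta>" and T1: "m \<mu> \<le> T1 \<Delta>" if "\<Delta> \<in> ?S" for \<Delta>
    proof -
      have "Delta_M \<tau> \<mu> - delta_mu \<kappa> c \<mu> \<le> \<Delta>" using that by (simp add: S_mu_def)
      moreover have "Delta_M \<tau> \<mu> - delta_mu \<kappa> c \<mu> > Delta_m \<kappa> \<mu>" using assms(9)[of \<mu>] \<mu> by simp
      ultimately show gt: "\<kappa> < \<Delta>" using mu by (simp add: Delta_m_def)
      have "Delta_M \<tau> \<mu> - delta_mu \<kappa> c \<mu> = (1 - \<mu>) * (1 - \<tau> - c) / \<mu> - \<kappa>"
        using mu by (simp add: Delta_M_def delta_mu_def field_simps)
      then have "m \<mu> \<le> (\<Delta> - 1 + \<mu> - \<kappa>) / (1 + \<mu>)"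
        using \<open>Delta_M \<tau> \<mu> - delta_mu \<kappa> c \<mu> \<le> \<Delta>\<close> mu
        unfolding m_def by (intro divide_right_mono) auto
      then show "m \<mu> \<le> T1 \<Delta>" using T1_ge[OF gt] by linarith
    qed
    interpret contracting_system \<kappa> \<tau> \<mu> ?S \<rho>
    proof
      show "closed ?S" by (simp add: S_mu_def)
      have "0 \<le> delta_mu \<kappa> c \<mu>" using assms(1,4) \<mu> \<open>\<mu>s < 1\<close> by (simp add: delta_mu_def)
      then show "?S \<noteq> {}" by (simp add: S_mu_def)
      show "Tmap \<kappa> \<tau> \<mu> \<Delta> \<in> ?S" if "\<Delta> \<in> ?S" for \<Delta> using assms(10)[of \<mu>] \<mu> that by auto
      show "completes_half_cycle \<Delta>" if "\<Delta> \<in> ?S" for \<Delta>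
      proof -
        have "exp (- T1 \<Delta>) \<le> exp (- m \<mu>)" using T1[OF that] by simp
        then show ?thesis using gt[OF that] small(1) unfolding completes_half_cycle_def by linarith
      qed
      show "\<bar>Tmap \<kappa> \<tau> \<mu> \<Delta> - Tmap \<kappa> \<tau> \<mu> \<Delta>'\<bar> \<le> \<rho> * \<bar>\<Delta> - \<Delta>'\<bar>"
        if "\<Delta> \<in> ?S" "\<Delta>' \<in> ?S" for \<Delta> \<Delta>'
      proof -
        have "(1 - \<mu>) / \<mu> * exp (- m \<mu>) * \<bar>\<Delta> - \<Delta>'\<bar> \<le> \<rho> * \<bar>\<Delta> - \<Delta>'\<bar>"
          using small(2) by (intro mult_right_mono) auto
        then show ?thesis using Tmap_lipschitz[of \<Delta> \<Delta>' "m \<mu>"] gt T1 that by fastforce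
      qed
    qed (use \<rho> in auto)
    obtain \<Delta>s where \<Delta>s: "\<Delta>s \<in> ?S" "Tmap \<kappa> \<tau> \<mu> \<Delta>s = \<Delta>s" by (rule ex_fixed_point)
    interpret system_with_fixed_point \<kappa> \<tau> \<mu> ?S \<rho> \<Delta>s by unfold_locales (use \<Delta>s in auto)
    obtain us where us: "traces \<Delta>s us" using ex_traces[OF \<Delta>s(1)] .
    show "?claim \<mu>"
    proof (rule exI[of _ \<Delta>s], rule exI[of _ "start \<Delta>s"], rule exI[of _ us],
        intro conjI allI impI ballI)
      show "periodic_equilibrium_from \<kappa> \<tau> c \<mu> \<Delta>s (start \<Delta>s) us"
        unfolding periodic_equilibrium_from_def
        using \<Delta>s us approx_solution_iff traces_nonconstant_periodic by blast
      show "us (t + start \<Delta>s 2) = us t" if "0 \<le> t" for t using traces_periodic us that .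
    next
      fix \<Delta>' \<sigma>' u' assume "periodic_equilibrium_from \<kappa> \<tau> c \<mu> \<Delta>' \<sigma>' u'"
      then have D': "\<Delta>' \<in> ?S" and u': "traces \<Delta>' u'" and "nonconstant_periodic u'"
        unfolding periodic_equilibrium_from_def using approx_solution_iff[of \<Delta>' \<sigma>' u'] by auto
      then obtain P where P: "0 < P" "\<forall>t\<ge>0. u' (t + P) = u' t"
        unfolding nonconstant_periodic_def by blast
      have "u' P = u' 0" using P(2)[rule_format, of 0] by simp
      with D' u' P(1) show eq: "\<Delta>' = \<Delta>s" by (rule periodic_starts_at_fixed_point)
      show "u' t = us t" if "0 \<le> t" for t
        using traces_unique[OF \<Delta>s(1) u'[unfolded eq] us that] .
    next
      fix \<Delta>0 k assume D0: "\<Delta>0 \<in> ?S"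
      have "\<bar>iter \<Delta>0 1 - \<Delta>0\<bar> \<le> delta_mu \<kappa> c \<mu>"
        using iter_in[OF D0, of 1] D0 by (auto simp: S_mu_def abs_le_iff)
      then have "\<rho> ^ k / (1 - \<rho>) * \<bar>iter \<Delta>0 1 - \<Delta>0\<bar> \<le> \<rho> ^ k / (1 - \<rho>) * delta_mu \<kappa> c \<mu>"
        using \<rho> by (intro mult_left_mono) auto
      then show "let \<Delta> = \<lambda>j. (Tmap \<kappa> \<tau> \<mu> ^^ j) \<Delta>0 in
          \<bar>\<Delta> k - \<Delta>s\<bar> \<le> \<rho> ^ k / (1 - \<rho>) * \<bar>\<Delta> 1 - \<Delta> 0\<bar> \<and>
          \<rho> ^ k / (1 - \<rho>) * \<bar>\<Delta> 1 - \<Delta> 0\<bar> \<le> delta_mu \<kappa> c \<mu> * (\<rho> ^ k / (1 - \<rho>))"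
        using iter_error[OF D0, of k] unfolding Let_def iter_def[symmetric] by (simp add: mult.commute)
    next
      fix \<Delta>0 assume D0: "\<Delta>0 \<in> ?S"
      obtain x where "traces \<Delta>0 x" using ex_traces[OF D0] .
      then show "\<exists>\<sigma> x. approx_solution \<kappa> \<tau> \<mu> \<Delta>0 \<sigma> x" using approx_solution_iff[OF D0] by auto
    next
      fix \<Delta>0 \<sigma> x assume D0: "\<Delta>0 \<in> ?S" and "approx_solution \<kappa> \<tau> \<mu> \<Delta>0 \<sigma> x"
      then have "\<sigma> = start \<Delta>0" and x: "traces \<Delta>0 x" using approx_solution_iff[OF D0] by auto
      then show "cycles_converge_geometrically (\<rho>\<^sup>2) \<sigma> x (start \<Delta>s) us"
        using traces_converge[OF D0 x us] by simp
    qed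
  qed (use assms b in auto)
qed

end
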